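(* Let $(X,\|\cdot\|)$ be an extended normed linear space with finest locally convex topology $\tau_F$. Then the following statements are equivalent: (1) $\tau_{ucb}$ is normable; (2) $\tau_F$ is normable; (3) $\tau_F$ is metrizable; (4) $X$ is almost conventional, that is, the dimension of $X/X_{fin}$ is finite.
   Context: Vector spaces are over $\mathbb{K}$, where $\mathbb{K}$ is $\mathbb{R}$ or $\mathbb{C}$. An extended norm on $X$ is a map $\|\cdot\|:X\to[0,\infty]$ with $\|x\|=0$ iff $x=0$, $\|\alpha x\|=|\alpha|\|x\|$ (convention $0\cdot\infty=0$) and $\|x+y\|\le\|x\|+\|y\|$. An extended normed linear space is a vector space with an extended norm, topologized by the metric $d(x,y)=\min\{1,\|x-y\|\}$. $X_{fin}=\{x\in X:\|x\|<\infty\}$. $X^*$ is the set of all continuous linear functionals $X\to\mathbb{K}$. The finest locally convex topology (flc topology) $\tau_F$ is the finest locally convex topology on $X$ (i.e. one induced by finite-valued seminorms) that is coarser than the topology of the extended norm. A set $A\subseteq X$ is bounded in $(X,\|\cdot\|)$ if for every neighborhood $U$ of $0$ there exist $r>0$ and a finite set $F\subseteq A$ such that $A\subseteq F+rU$. $\tau_{ucb}$ is the locally convex topology on $X^*$ induced by the seminorms $f\mapsto\sup_{x\in B}|f(x)|$ with $B$ bounded in $(X,\|\cdot\|)$. *)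

theory Defs
  imports "HOL-Analysis.Analysis" "HOL-Library.Function_Algebras"
begin

section \<open>Extended normed linear spaces\<close>

text \<open>The space is the whole type; the scalar field is only instantiated by the real and the
  complex numbers. In \<^typ>\<open>ennreal\<close>, zero times infinity is zero.\<close>

locale extended_normed_space = vector_space sc
  for sc :: "'k::real_normed_field \<Rightarrow> 'a::ab_group_add \<Rightarrow> 'a" +
  fixes N :: "'a \<Rightarrow> ennreal"
  assumes ext_norm_eq_zero_iff: "N x = 0 \<longleftrightarrow> x = 0"
    and ext_norm_scale: "N (sc c x) = ennreal (norm c) * N x"
    and ext_norm_triangle: "N (x + y) \<le> N x + N y"

definition ext_dist :: "('a::ab_group_add \<Rightarrow> ennreal) \<Rightarrow> 'a \<Rightarrow> 'a \<Rightarrow> real"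
  where "ext_dist N x y = enn2real (min 1 (N (x - y)))"

definition ext_topology :: "('a::ab_group_add \<Rightarrow> ennreal) \<Rightarrow> 'a topology"
  where "ext_topology N = Metric_space.mtopology UNIV (ext_dist N)"

definition fin_subspace :: "('a \<Rightarrow> ennreal) \<Rightarrow> 'a set"
  where "fin_subspace N = {x. N x < \<infinity>}"


section \<open>Seminorms, locally convex topologies and normability\<close>

text \<open>The carrier \<open>V\<close> is meant to be a linear subspace of the ambient type. It is needed because
  the continuous dual is not a type of its own.\<close>

definition seminorm_on ::
    "('k::real_normed_field \<Rightarrow> 'v::ab_group_add \<Rightarrow> 'v) \<Rightarrow> 'v set \<Rightarrow> ('v \<Rightarrow> real) \<Rightarrow> bool"
  where "seminorm_on sc V p \<longleftrightarrow>
    (\<forall>x\<in>V. 0 \<le> p x) \<and>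
    (\<forall>c. \<forall>x\<in>V. p (sc c x) = norm c * p x) \<and>
    (\<forall>x\<in>V. \<forall>y\<in>V. p (x + y) \<le> p x + p y)"

definition norm_on ::
    "('k::real_normed_field \<Rightarrow> 'v::ab_group_add \<Rightarrow> 'v) \<Rightarrow> 'v set \<Rightarrow> ('v \<Rightarrow> real) \<Rightarrow> bool"
  where "norm_on sc V p \<longleftrightarrow> seminorm_on sc V p \<and> (\<forall>x\<in>V. p x = 0 \<longrightarrow> x = 0)"

text \<open>The open balls of the given seminorms form a subbasis; \<open>V\<close> itself is added so that the
  empty family induces the indiscrete topology on \<open>V\<close>.\<close>

definition seminorm_topology :: "'v::ab_group_add set \<Rightarrow> ('v \<Rightarrow> real) set \<Rightarrow> 'v topology"
  where "seminorm_topology V P = topology_generated_by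
    (insert V {{y \<in> V. p (y - x) < e} | p x e. p \<in> P \<and> x \<in> V \<and> 0 < e})"

definition locally_convex_topology ::
    "('k::real_normed_field \<Rightarrow> 'v::ab_group_add \<Rightarrow> 'v) \<Rightarrow> 'v set \<Rightarrow> 'v topology \<Rightarrow> bool"
  where "locally_convex_topology sc V T \<longleftrightarrow>
    (\<exists>P. (\<forall>p\<in>P. seminorm_on sc V p) \<and> T = seminorm_topology V P)"

definition normable ::
    "('k::real_normed_field \<Rightarrow> 'v::ab_group_add \<Rightarrow> 'v) \<Rightarrow> 'v set \<Rightarrow> 'v topology \<Rightarrow> bool"
  where "normable sc V T \<longleftrightarrow> (\<exists>p. norm_on sc V p \<and> T = seminorm_topology V {p})"

definition coarser :: "'v topology \<Rightarrow> 'v topology \<Rightarrow> bool"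
  where "coarser T T' \<longleftrightarrow> (\<forall>U. openin T U \<longrightarrow> openin T' U)"


section \<open>The finest locally convex topology\<close>

definition is_flc_topology ::
    "('k::real_normed_field \<Rightarrow> 'a::ab_group_add \<Rightarrow> 'a) \<Rightarrow> ('a \<Rightarrow> ennreal) \<Rightarrow> 'a topology \<Rightarrow> bool"
  where "is_flc_topology sc N T \<longleftrightarrow>
    locally_convex_topology sc UNIV T \<and> coarser T (ext_topology N) \<and>
    (\<forall>T'. locally_convex_topology sc UNIV T' \<and> coarser T' (ext_topology N) \<longrightarrow> coarser T' T)"

text \<open>The description is legitimate in every extended normed space: see
  \<open>is_flc_topology_flc_topology\<close> below.\<close>

definition flc_topology ::
    "('k::real_normed_field \<Rightarrow> 'a::ab_group_add \<Rightarrow> 'a) \<Rightarrow> ('a \<Rightarrow> ennreal) \<Rightarrow> 'a topology"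
  where "flc_topology sc N = (THE T. is_flc_topology sc N T)"

lemma coarser_antisym: "coarser T T' \<Longrightarrow> coarser T' T \<Longrightarrow> T = T'"
  by (auto simp: coarser_def topology_eq)

lemma coarser_trans: "coarser T T' \<Longrightarrow> coarser T' T'' \<Longrightarrow> coarser T T''"
  by (auto simp: coarser_def)

lemma coarser_generated:
  assumes "\<And>U. U \<in> S \<Longrightarrow> openin T U"
  shows "coarser (topology_generated_by S) T"
  unfolding coarser_def
proof (intro allI impI)
  fix U assume "openin (topology_generated_by S) U"
  then have "generate_topology_on S U"
    by (simp add: openin_topology_generated_by_iff)
  then show "openin T U"
    by induction (use assms in auto)
qed

lemma coarser_seminorm_topology_mono:
  "P \<subseteq> Q \<Longrightarrow> coarser (seminorm_topology V P) (seminorm_topology V Q)"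
  unfolding seminorm_topology_def
  by (intro coarser_generated topology_generated_by_Basis) blast

lemma (in extended_normed_space) ext_norm_minus: "N (- x) = N x"
  using ext_norm_scale[of "-1" x] by simp

lemma (in extended_normed_space) Metric_space_ext_dist: "Metric_space UNIV (ext_dist N)"
proof
  fix x y z :: 'a
  show "0 \<le> ext_dist N x y" by (simp add: ext_dist_def)
  show "ext_dist N x y = ext_dist N y x"
    using ext_norm_minus[of "x - y"] by (simp add: ext_dist_def)
  show "ext_dist N x y = 0 \<longleftrightarrow> x = y"
    using ext_norm_eq_zero_iff[of "x - y"]
    by (auto simp: ext_dist_def enn2real_eq_0_iff min_def top_unique split: if_splits)
  have "N (x - z) \<le> N (x - y) + N (y - z)"
    using ext_norm_triangle[of "x - y" "y - z"] by simp
  then have *: "min 1 (N (x - z)) \<le> min 1 (N (x - y)) + min 1 (N (y - z))"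
    by (smt (verit) add_increasing add_increasing2 add_mono min_def order_trans zero_le linorder_le_cases)
  have fin: "min 1 (N u) < top" for u
    by (simp add: min_less_iff_disj)
  show "ext_dist N x z \<le> ext_dist N x y + ext_dist N y z"
    unfolding ext_dist_def
    using enn2real_mono[OF *] fin by (simp add: enn2real_plus ennreal_add_less_top)
qed

lemma (in extended_normed_space) is_flc_topology_ex1: "\<exists>!T. is_flc_topology sc N T"
proof (rule ex_ex1I)
  let ?E = "ext_topology N"
  define P where "P = {p. seminorm_on sc UNIV p \<and> coarser (seminorm_topology UNIV {p}) ?E}"
  have UNIV_open: "openin ?E UNIV"
    unfolding ext_topology_def
    using openin_topspace Metric_space.topspace_mtopology[OF Metric_space_ext_dist] by metis
  have "openin ?E {y. p (y - x) < e}" if "p \<in> P" "0 < e" for p x e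
  proof -
    have "openin (seminorm_topology UNIV {p}) {y. p (y - x) < e}"
      unfolding seminorm_topology_def
      by (intro topology_generated_by_Basis) (use that in auto)
    then show ?thesis using that by (auto simp: P_def coarser_def)
  qed
  then have 1: "coarser (seminorm_topology UNIV P) ?E"
    unfolding seminorm_topology_def
    by (intro coarser_generated) (use UNIV_open in auto)
  have 2: "coarser (seminorm_topology UNIV Q) (seminorm_topology UNIV P)"
    if Q: "\<forall>p\<in>Q. seminorm_on sc UNIV p" "coarser (seminorm_topology UNIV Q) ?E" for Q
  proof (rule coarser_seminorm_topology_mono)
    show "Q \<subseteq> P"
      unfolding P_def
      using Q coarser_seminorm_topology_mono[of "{_}" Q UNIV] coarser_trans by blast
  qed
  show "\<exists>T. is_flc_topology sc N T"
  proof
    have "locally_convex_topology sc UNIV (seminorm_topology UNIV P)"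
      unfolding locally_convex_topology_def by (rule exI[of _ P]) (simp add: P_def)
    then show "is_flc_topology sc N (seminorm_topology UNIV P)"
      using 1 2 unfolding is_flc_topology_def by (auto simp: locally_convex_topology_def[of _ _ T' for T'])
  qed
  show "T = T'" if "is_flc_topology sc N T" "is_flc_topology sc N T'" for T T'
    using that by (auto simp: is_flc_topology_def intro: coarser_antisym)
qed

lemma (in extended_normed_space) is_flc_topology_flc_topology:
  "is_flc_topology sc N (flc_topology sc N)"
  unfolding flc_topology_def by (rule theI'[OF is_flc_topology_ex1])


section \<open>The dual and uniform convergence on bounded sets\<close>

definition cont_dual ::
    "('k::real_normed_field \<Rightarrow> 'a::ab_group_add \<Rightarrow> 'a) \<Rightarrow> ('a \<Rightarrow> ennreal) \<Rightarrow> ('a \<Rightarrow> 'k) set"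
  where "cont_dual sc N =
    {f. Vector_Spaces.linear sc (*) f \<and> continuous_map (ext_topology N) euclidean f}"

definition dual_scale :: "'k::real_normed_field \<Rightarrow> ('a \<Rightarrow> 'k) \<Rightarrow> 'a \<Rightarrow> 'k"
  where "dual_scale c f = (\<lambda>x. c * f x)"

definition ext_bounded ::
    "('k::real_normed_field \<Rightarrow> 'a::ab_group_add \<Rightarrow> 'a) \<Rightarrow> ('a \<Rightarrow> ennreal) \<Rightarrow> 'a set \<Rightarrow> bool"
  where "ext_bounded sc N A \<longleftrightarrow>
    (\<forall>U. (\<exists>W. openin (ext_topology N) W \<and> 0 \<in> W \<and> W \<subseteq> U) \<longrightarrow>
      (\<exists>r::real. 0 < r \<and> (\<exists>F. finite F \<and> F \<subseteq> A \<and> A \<subseteq> {a + sc (of_real r) u | a u. a \<in> F \<and> u \<in> U})))"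

text \<open>Inserting 0 makes the supremum over the empty set 0 and changes nothing otherwise. The
  supremum is finite for every continuous functional, since \<open>B\<close> will be bounded.\<close>

definition sup_seminorm :: "'a set \<Rightarrow> ('a \<Rightarrow> 'k::real_normed_field) \<Rightarrow> real"
  where "sup_seminorm B f = Sup (insert 0 ((\<lambda>x. norm (f x)) ` B))"

definition ucb_topology ::
    "('k::real_normed_field \<Rightarrow> 'a::ab_group_add \<Rightarrow> 'a) \<Rightarrow> ('a \<Rightarrow> ennreal) \<Rightarrow> ('a \<Rightarrow> 'k) topology"
  where "ucb_topology sc N =
    seminorm_topology (cont_dual sc N) {sup_seminorm B | B. ext_bounded sc N B}"


section \<open>Almost conventional spaces\<close>

text \<open>The quotient of the whole space by a subspace \<open>S\<close>, as the set of cosets of \<open>S\<close>. Adding \<open>S\<close> in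
  the scalar multiplication only matters for the scalar 0, where it gives the zero coset \<open>S\<close>.\<close>

definition quot_space :: "'a::ab_group_add set \<Rightarrow> 'a set set"
  where "quot_space S = range (\<lambda>x. {x + s | s. s \<in> S})"

definition quot_add :: "'a::ab_group_add set \<Rightarrow> 'a set \<Rightarrow> 'a set"
  where "quot_add C D = {c + d | c d. c \<in> C \<and> d \<in> D}"

definition quot_scale :: "('k \<Rightarrow> 'a::ab_group_add \<Rightarrow> 'a) \<Rightarrow> 'a set \<Rightarrow> 'k \<Rightarrow> 'a set \<Rightarrow> 'a set"
  where "quot_scale sc S k C = {sc k c + s | c s. c \<in> C \<and> s \<in> S}"

inductive_set quot_span :: "('k \<Rightarrow> 'a::ab_group_add \<Rightarrow> 'a) \<Rightarrow> 'a set \<Rightarrow> 'a set set \<Rightarrow> 'a set set"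
  for sc S \<B> where
  zero: "S \<in> quot_span sc S \<B>"
| step: "C \<in> \<B> \<Longrightarrow> D \<in> quot_span sc S \<B> \<Longrightarrow>
    quot_add (quot_scale sc S k C) D \<in> quot_span sc S \<B>"

definition quot_finite_dim :: "('k \<Rightarrow> 'a::ab_group_add \<Rightarrow> 'a) \<Rightarrow> 'a set \<Rightarrow> bool"
  where "quot_finite_dim sc S \<longleftrightarrow>
    (\<exists>\<B>. finite \<B> \<and> \<B> \<subseteq> quot_space S \<and> quot_span sc S \<B> = quot_space S)"

definition almost_conventional ::
    "('k::real_normed_field \<Rightarrow> 'a::ab_group_add \<Rightarrow> 'a) \<Rightarrow> ('a \<Rightarrow> ennreal) \<Rightarrow> bool"
  where "almost_conventional sc N \<longleftrightarrow> quot_finite_dim sc (fin_subspace N)"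

end

theory Submission
  imports Defs
begin

text \<open>
  Write \<open>X\<^sub>f\<^sub>i\<^sub>n\<close> for the subspace of vectors of finite norm. It is open, and the extended norm
  measures nothing outside it: a seminorm or a linear functional is continuous as soon as it is
  bounded by a multiple of the norm on \<open>X\<^sub>f\<^sub>i\<^sub>n\<close> (\<open>ext_cont_seminorm_iff\<close>, \<open>cont_dual_iff\<close>). In
  particular a functional that vanishes on \<open>X\<^sub>f\<^sub>i\<^sub>n\<close> is continuous, whatever values it takes on a
  complement, and a continuous seminorm grows on a complement as it likes. All four conditions
  say that the complement is too small for this freedom to do harm.

  If \<open>X / X\<^sub>f\<^sub>i\<^sub>n\<close> has finite dimension, choose coordinates \<open>\<phi>\<^sub>d\<close> modulo \<open>X\<^sub>f\<^sub>i\<^sub>n\<close>, one for each vector \<open>d\<close>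
  of a finite set \<open>D\<close>, and let \<open>b x = x - (\<Sum>d\<in>D. \<phi>\<^sub>d x d)\<close> be the part of \<open>x\<close> in \<open>X\<^sub>f\<^sub>i\<^sub>n\<close>. Then
  \<open>q x = N (b x) + (\<Sum>d\<in>D. \<bar>\<phi>\<^sub>d x\<bar>)\<close> is a continuous norm that dominates every continuous seminorm,
  so it induces the finest locally convex topology. Dually, the unit ball together with \<open>D\<close> is a
  bounded set, and the supremum over it is a norm on the dual that dominates the supremum over
  every other bounded set.

  If \<open>X / X\<^sub>f\<^sub>i\<^sub>n\<close> has infinite dimension, neither topology can be described by so few seminorms.
  Were the finest locally convex topology metrizable, one could scale a sequence of vectors that
  is linearly independent modulo \<open>X\<^sub>f\<^sub>i\<^sub>n\<close> to a null sequence; but some functional vanishes on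
  \<open>X\<^sub>f\<^sub>i\<^sub>n\<close>, hence is continuous, and takes the value 1 along the sequence. Were the topology of the
  dual given by a norm \<open>\<rho>\<close>, the unit ball of \<open>\<rho>\<close> would contain all functionals that are small on
  certain finitely many bounded sets. Each bounded set lies in finitely many translates of
  \<open>X\<^sub>f\<^sub>i\<^sub>n\<close>, so some functional \<open>f \<noteq> 0\<close> vanishes on all of them, and the unit ball of \<open>\<rho>\<close> contains
  every multiple of \<open>f\<close>.

  The argument works over any normed field that contains the reals, and the real and the
  complex case are two instances of it.
\<close>

section \<open>Topologies induced by seminorms\<close>

lemma seminorm_onD:
  assumes "seminorm_on sc V p"
  shows seminorm_on_nonneg: "x \<in> V \<Longrightarrow> 0 \<le> p x"
    and seminorm_on_scale: "x \<in> V \<Longrightarrow> p (sc c x) = norm c * p x"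
    and seminorm_on_triangle: "x \<in> V \<Longrightarrow> y \<in> V \<Longrightarrow> p (x + y) \<le> p x + p y"
  using assms by (auto simp: seminorm_on_def)

text \<open>A finite intersection of subbasic sets with common centre and radius; for the empty family
  it is all of \<open>V\<close>.\<close>

definition seminorm_ball :: "'v::ab_group_add set \<Rightarrow> ('v \<Rightarrow> real) set \<Rightarrow> 'v \<Rightarrow> real \<Rightarrow> 'v set"
  where "seminorm_ball V Q x e = {y \<in> V. \<forall>p\<in>Q. p (y - x) < e}"

lemma coarser_seminorm_topology_singleton:
  assumes "openin T V" "\<And>x e. x \<in> V \<Longrightarrow> openin T {y \<in> V. p (y - x) < e}"
  shows "coarser (seminorm_topology V {p}) T"
  unfolding seminorm_topology_def
proof (rule coarser_generated)
  fix U assume "U \<in> insert V {{y \<in> V. q (y - x) < e} | q x e. q \<in> {p} \<and> x \<in> V \<and> 0 < e}"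
  then consider "U = V" | x e where "x \<in> V" "U = {y \<in> V. p (y - x) < e}" by blast
  then show "openin T U" by cases (simp_all add: assms)
qed

text \<open>The setting covers both the space itself and its continuous dual; the latter is only a
  subset of a function type. The laws for 0 make seminorms vanish at 0, and closure under
  differences lets the triangle inequality compare balls around different centres.\<close>

locale seminorm_family =
  fixes sc :: "'k::real_normed_field \<Rightarrow> 'v::ab_group_add \<Rightarrow> 'v" and V :: "'v set"
    and P :: "('v \<Rightarrow> real) set"
  assumes zero_mem: "0 \<in> V"
    and diff_mem: "\<And>x y. x \<in> V \<Longrightarrow> y \<in> V \<Longrightarrow> x - y \<in> V"
    and scale_0: "sc 0 0 = 0"
    and seminorms: "\<And>p. p \<in> P \<Longrightarrow> seminorm_on sc V p"
begin

lemma seminorm_0: "p \<in> P \<Longrightarrow> p 0 = 0"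
  using seminorm_on_scale[OF seminorms zero_mem, of p 0] scale_0 by simp

lemma seminorm_ball_open_ball:
  assumes "p \<in> P" "a \<in> V" "x \<in> V"
  shows "seminorm_ball V {p} x (d - p (x - a)) \<subseteq> {y \<in> V. p (y - a) < d}"
proof
  fix y assume y: "y \<in> seminorm_ball V {p} x (d - p (x - a))"
  then have "p ((y - x) + (x - a)) \<le> p (y - x) + p (x - a)"
    using assms by (intro seminorm_on_triangle[OF seminorms] diff_mem) (auto simp: seminorm_ball_def)
  then show "y \<in> {y \<in> V. p (y - a) < d}" using y by (simp add: seminorm_ball_def)
qed

lemma centre_in_seminorm_ball: "Q \<subseteq> P \<Longrightarrow> x \<in> V \<Longrightarrow> 0 < e \<Longrightarrow> x \<in> seminorm_ball V Q x e"
  by (auto simp: seminorm_ball_def seminorm_0 subset_iff)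

lemma openin_seminorm_ball:
  assumes "finite Q" "Q \<subseteq> P" "x \<in> V" "0 < e"
  shows "openin (seminorm_topology V P) (seminorm_ball V Q x e)"
  using assms(1,2)
proof induction
  case empty
  have "openin (seminorm_topology V P) V"
    unfolding seminorm_topology_def by (rule topology_generated_by_Basis) simp
  then show ?case by (simp add: seminorm_ball_def)
next
  case (insert p Q)
  have "openin (seminorm_topology V P) {y \<in> V. p (y - x) < e}"
    unfolding seminorm_topology_def
    by (rule topology_generated_by_Basis) (use insert assms(3,4) in blast)
  moreover have "openin (seminorm_topology V P) (seminorm_ball V Q x e)"
    using insert by simp
  moreover have "seminorm_ball V (insert p Q) x e = {y \<in> V. p (y - x) < e} \<inter> seminorm_ball V Q x e"
    by (auto simp: seminorm_ball_def)
  ultimately show ?case by (simp add: openin_Int)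
qed

lemma openin_unit_ball:
  assumes "p \<in> P"
  shows "openin (seminorm_topology V P) {y \<in> V. p y < 1}"
proof -
  have "openin (seminorm_topology V P) (seminorm_ball V {p} 0 1)"
    using assms zero_mem by (intro openin_seminorm_ball) auto
  then show ?thesis by (simp add: seminorm_ball_def)
qed

text \<open>The subbasis consists of balls of single seminorms around arbitrary centres. By the triangle
  inequality such a ball contains a smaller one around each of its points, so balls centred at the
  given point suffice.\<close>

lemma openin_seminorm_topology_iff:
  "openin (seminorm_topology V P) U \<longleftrightarrow>
    U \<subseteq> V \<and> (\<forall>x\<in>U. \<exists>Q e. finite Q \<and> Q \<subseteq> P \<and> 0 < e \<and> seminorm_ball V Q x e \<subseteq> U)"
proof
  define nbhd where
    "nbhd U x \<longleftrightarrow> (\<exists>Q e. finite Q \<and> Q \<subseteq> P \<and> 0 < e \<and> seminorm_ball V Q x e \<subseteq> U)" for U x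
  assume "openin (seminorm_topology V P) U"
  then have "generate_topology_on
      (insert V {{y \<in> V. p (y - x) < e} | p x e. p \<in> P \<and> x \<in> V \<and> 0 < e}) U"
    by (simp add: seminorm_topology_def openin_topology_generated_by_iff)
  then have "U \<subseteq> V \<and> (\<forall>x\<in>U. nbhd U x)"
  proof induction
    case Empty
    then show ?case by simp
  next
    case (Int A B)
    have "nbhd (A \<inter> B) x" if x: "x \<in> A \<inter> B" for x
    proof -
      obtain Q e where Q: "finite Q" "Q \<subseteq> P" "0 < e" "seminorm_ball V Q x e \<subseteq> A"
        using Int.IH(1) x unfolding nbhd_def by blast
      obtain Q' e' where Q': "finite Q'" "Q' \<subseteq> P" "0 < e'" "seminorm_ball V Q' x e' \<subseteq> B"
        using Int.IH(2) x unfolding nbhd_def by blast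
      have "seminorm_ball V (Q \<union> Q') x (min e e') \<subseteq> seminorm_ball V Q x e \<inter> seminorm_ball V Q' x e'"
        by (auto simp: seminorm_ball_def)
      then have "seminorm_ball V (Q \<union> Q') x (min e e') \<subseteq> A \<inter> B"
        using Q(4) Q'(4) by blast
      then show ?thesis
        unfolding nbhd_def using Q Q' by (intro exI[of _ "Q \<union> Q'"] exI[of _ "min e e'"]) simp
    qed
    then show ?case using Int.IH by blast
  next
    case (UN K)
    have "nbhd (\<Union>K) x" if "x \<in> k" "k \<in> K" for x k
      using UN[OF that(2)] that unfolding nbhd_def by (meson Union_upper subset_trans)
    then show ?case using UN by blast
  next
    case (Basis A)
    then consider "A = V"
      | p a d where "A = {y \<in> V. p (y - a) < d}" "p \<in> P" "a \<in> V" "0 < d" by blast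
    then show ?case
    proof cases
      case 1
      have "nbhd V x" for x
        unfolding nbhd_def by (intro exI[of _ "{}"] exI[of _ "1::real"]) (simp add: seminorm_ball_def)
      then show ?thesis using 1 by simp
    next
      case 2
      have "nbhd A x" if x: "x \<in> A" for x
        unfolding nbhd_def using x 2 seminorm_ball_open_ball[of p a x d]
        by (intro exI[of _ "{p}"] exI[of _ "d - p (x - a)"]) simp
      then show ?thesis using 2 by blast
    qed
  qed
  then show "U \<subseteq> V \<and> (\<forall>x\<in>U. \<exists>Q e. finite Q \<and> Q \<subseteq> P \<and> 0 < e \<and> seminorm_ball V Q x e \<subseteq> U)"
    by (simp add: nbhd_def)
next
  assume U: "U \<subseteq> V \<and> (\<forall>x\<in>U. \<exists>Q e. finite Q \<and> Q \<subseteq> P \<and> 0 < e \<and> seminorm_ball V Q x e \<subseteq> U)"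
  have "\<exists>W. openin (seminorm_topology V P) W \<and> x \<in> W \<and> W \<subseteq> U" if x: "x \<in> U" for x
  proof -
    obtain Q e where Q: "finite Q" "Q \<subseteq> P" "0 < e" "seminorm_ball V Q x e \<subseteq> U"
      using U x by blast
    moreover have "x \<in> V" using U x by blast
    ultimately show ?thesis
      using openin_seminorm_ball centre_in_seminorm_ball by meson
  qed
  then show "openin (seminorm_topology V P) U"
    by (subst openin_subopen) blast
qed

lemma nbhd_contains_ball:
  assumes "openin (seminorm_topology V P) U" "x \<in> U"
  obtains Q e where "finite Q" "Q \<subseteq> P" "0 < e" "seminorm_ball V Q x e \<subseteq> U"
proof -
  have "\<exists>Q e. finite Q \<and> Q \<subseteq> P \<and> 0 < e \<and> seminorm_ball V Q x e \<subseteq> U"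
    using assms(1)[unfolded openin_seminorm_topology_iff, THEN conjunct2] assms(2) by (rule bspec)
  then show thesis by (elim exE conjE) (rule that)
qed

lemma nbhd_0_contains_ball:
  assumes "openin (seminorm_topology V P) U" "0 \<in> U"
  obtains Q e where "finite Q" "Q \<subseteq> P" "0 < e" "\<forall>y\<in>V. (\<forall>p\<in>Q. p y < e) \<longrightarrow> y \<in> U"
proof -
  obtain Q e where Q: "finite Q" "Q \<subseteq> P" "0 < e" and sub: "seminorm_ball V Q 0 e \<subseteq> U"
    using assms by (rule nbhd_contains_ball)
  have "\<forall>y\<in>V. (\<forall>p\<in>Q. p y < e) \<longrightarrow> y \<in> U"
    using sub by (auto simp: seminorm_ball_def)
  with Q show thesis by (rule that)
qed

text \<open>The factor \<open>C\<close> may depend on the seminorm, because a neighbourhood involves only finitely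
  many seminorms. This is how a single norm is recognised as inducing a topology that is defined
  by many seminorms.\<close>

lemma coarser_seminorm_topology_dominated:
  assumes q: "seminorm_on sc V q"
    and dom: "\<And>p. p \<in> P \<Longrightarrow> \<exists>C. \<forall>x\<in>V. p x \<le> C * q x"
  shows "coarser (seminorm_topology V P) (seminorm_topology V {q})"
  unfolding coarser_def
proof (intro allI impI)
  interpret q: seminorm_family sc V "{q}"
    by unfold_locales (use zero_mem diff_mem scale_0 q in auto)
  fix U assume U: "openin (seminorm_topology V P) U"
  show "openin (seminorm_topology V {q}) U"
    unfolding q.openin_seminorm_topology_iff
  proof (intro conjI ballI)
    show "U \<subseteq> V" using U unfolding openin_seminorm_topology_iff by (rule conjunct1)
    fix x assume x: "x \<in> U"
    obtain Q e where Q: "finite Q" "Q \<subseteq> P" "0 < e" "seminorm_ball V Q x e \<subseteq> U"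
      using U x by (rule nbhd_contains_ball)
    obtain C where C: "\<And>p y. p \<in> Q \<Longrightarrow> y \<in> V \<Longrightarrow> p y \<le> C p * q y"
      using dom Q(2) by (metis subsetD)
    \<comment> \<open>The summand 1 keeps \<open>K\<close> positive, also when \<open>Q\<close> is empty, so that \<open>e / K\<close> is a radius.\<close>
    define K where "K = 1 + (\<Sum>p\<in>Q. \<bar>C p\<bar>)"
    have K: "0 < K" unfolding K_def by (simp add: add_pos_nonneg sum_nonneg)
    have "p y \<le> K * q y" if "p \<in> Q" "y \<in> V" for p y
    proof -
      have "C p \<le> K"
        using member_le_sum[of p Q "\<lambda>p. \<bar>C p\<bar>"] Q(1) that(1) by (simp add: K_def)
      then show ?thesis
        using C[OF that] seminorm_on_nonneg[OF q that(2)] by (meson mult_right_mono order_trans)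
    qed
    note K_dom = this
    have "seminorm_ball V {q} x (e / K) \<subseteq> seminorm_ball V Q x e"
      unfolding seminorm_ball_def
    proof (intro subsetI CollectI conjI ballI)
      fix y p assume y: "y \<in> {y \<in> V. \<forall>p\<in>{q}. p (y - x) < e / K}" and p: "p \<in> Q"
      then have "y - x \<in> V" using x \<open>U \<subseteq> V\<close> diff_mem by blast
      then have "p (y - x) \<le> K * q (y - x)" by (rule K_dom[OF p])
      also have "\<dots> < e" using y K by (simp add: field_simps)
      finally show "p (y - x) < e" .
    qed auto
    then show "\<exists>Q e. finite Q \<and> Q \<subseteq> {q} \<and> 0 < e \<and> seminorm_ball V Q x e \<subseteq> U"
      using Q(3,4) K by (intro exI[of _ "{q}"] exI[of _ "e / K"]) auto
  qed
qed

end

lemma metrizable_space_of_normable: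
  assumes "normable sc UNIV T" "sc 0 0 = 0" "\<And>x. sc (-1) x = - x"
  shows "metrizable_space T"
proof -
  obtain q where q: "norm_on sc UNIV q" and T: "T = seminorm_topology UNIV {q}"
    using assms(1) by (auto simp: normable_def)
  have sq: "seminorm_on sc UNIV q" using q by (simp add: norm_on_def)
  interpret seminorm_family sc UNIV "{q}"
    by unfold_locales (use assms sq in auto)
  have q0: "q x = 0 \<longleftrightarrow> x = 0" for x
    using q seminorm_0 by (auto simp: norm_on_def)
  interpret d: Metric_space UNIV "\<lambda>x y. q (x - y)"
  proof
    fix x y z
    show "0 \<le> q (x - y)" using seminorm_on_nonneg[OF sq] by simp
    show "q (x - y) = q (y - x)"
      using seminorm_on_scale[OF sq, of "y - x" "-1"] assms(3) by simp
    show "q (x - y) = 0 \<longleftrightarrow> x = y" using q0 by simp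
    show "q (x - z) \<le> q (x - y) + q (y - z)"
      using seminorm_on_triangle[OF sq, of "x - y" "y - z"] by simp
  qed
  have "openin T U \<longleftrightarrow> openin d.mtopology U" for U
  proof
    assume "openin T U"
    show "openin d.mtopology U"
      unfolding d.openin_mtopology
    proof (intro conjI allI impI)
      fix x assume "x \<in> U"
      with \<open>openin T U\<close> obtain Q e
        where Q: "Q \<subseteq> {q}" "0 < e" "seminorm_ball UNIV Q x e \<subseteq> U"
        unfolding T by (rule nbhd_contains_ball)
      have "d.mball x e \<subseteq> U"
        using Q d.commute[of x] by (auto simp: d.mball_def seminorm_ball_def subset_iff)
      then show "\<exists>r>0. d.mball x r \<subseteq> U" using Q(2) by blast
    qed simp
  next
    assume U: "openin d.mtopology U"
    show "openin T U"
      unfolding T openin_seminorm_topology_iff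
    proof (intro conjI ballI)
      fix x assume "x \<in> U"
      then obtain r where "r > 0" "d.mball x r \<subseteq> U"
        using U unfolding d.openin_mtopology by blast
      then show "\<exists>Q e. finite Q \<and> Q \<subseteq> {q} \<and> 0 < e \<and> seminorm_ball UNIV Q x e \<subseteq> U"
        using d.commute[of x]
        by (intro exI[of _ "{q}"] exI[of _ r]) (auto simp: d.mball_def seminorm_ball_def)
    qed simp
  qed
  then have "T = d.mtopology" by (simp add: topology_eq)
  then show ?thesis using d.metrizable_space_mtopology by simp
qed


section \<open>Quotients of finite dimension\<close>

context vector_space
begin

lemma quot_space_eq: "quot_space S = range (\<lambda>x. (+) x ` S)"
  unfolding quot_space_def by (simp add: setcompr_eq_image)

lemma quot_add_coset:
  assumes "subspace S"
  shows "quot_add ((+) x ` S) ((+) y ` S) = (+) (x + y) ` S"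
proof (intro subset_antisym subsetI)
  fix z assume "z \<in> quot_add ((+) x ` S) ((+) y ` S)"
  then obtain s t where "z = x + s + (y + t)" "s \<in> S" "t \<in> S"
    unfolding quot_add_def by blast
  then show "z \<in> (+) (x + y) ` S"
    using assms by (intro image_eqI[of _ _ "s + t"] subspace_add) (simp_all add: add_ac)
next
  fix z assume "z \<in> (+) (x + y) ` S"
  then obtain s where s: "z = x + y + s" "s \<in> S" by blast
  then have "z = (x + s) + (y + 0)" by (simp add: add_ac)
  moreover have "x + s \<in> (+) x ` S" "y + 0 \<in> (+) y ` S"
    using s subspace_0[OF assms] by (auto simp del: add_0_right)
  ultimately show "z \<in> quot_add ((+) x ` S) ((+) y ` S)"
    unfolding quot_add_def by blast
qed

lemma quot_scale_coset:
  assumes "subspace S"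
  shows "quot_scale scale S k ((+) x ` S) = (+) (scale k x) ` S"
proof (intro subset_antisym subsetI)
  fix z assume "z \<in> quot_scale scale S k ((+) x ` S)"
  then obtain s t where "z = scale k (x + s) + t" "s \<in> S" "t \<in> S"
    unfolding quot_scale_def by blast
  then show "z \<in> (+) (scale k x) ` S"
    using assms by (intro image_eqI[of _ _ "scale k s + t"] subspace_add subspace_scale)
      (simp_all add: scale_right_distrib add_ac)
next
  fix z assume "z \<in> (+) (scale k x) ` S"
  then obtain s where s: "z = scale k (x + 0) + s" "s \<in> S" by auto
  moreover have "x + 0 \<in> (+) x ` S"
    using subspace_0[OF assms] by blast
  ultimately show "z \<in> quot_scale scale S k ((+) x ` S)"
    unfolding quot_scale_def by blast
qed

text \<open>This replaces the explicit calculus of cosets by a statement about spans in the space itself,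
  which is the only form in which finite dimension of the quotient is used below.\<close>

lemma quot_finite_dim_iff:
  assumes S: "subspace S"
  shows "quot_finite_dim scale S \<longleftrightarrow> (\<exists>E. finite E \<and> span (E \<union> S) = UNIV)"
proof
  assume "quot_finite_dim scale S"
  then obtain \<B> where \<B>: "finite \<B>" "\<B> \<subseteq> quot_space S" "quot_span scale S \<B> = quot_space S"
    by (auto simp: quot_finite_dim_def)
  then obtain E where E: "finite E" "\<B> = (\<lambda>x. (+) x ` S) ` E"
    unfolding quot_space_eq by (metis finite_subset_image)
  have "D \<subseteq> span (E \<union> S)" if "D \<in> quot_span scale S \<B>" for D
    using that
  proof induction
    case zero
    then show ?case using span_superset by blast
  next
    case (step C D k)
    then obtain e where e: "e \<in> E" "C = (+) e ` S" using E by blast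
    show ?case
    proof
      fix z assume "z \<in> quot_add (quot_scale scale S k C) D"
      then obtain s t d where z: "z = scale k (e + s) + t + d" "s \<in> S" "t \<in> S" "d \<in> D"
        unfolding quot_add_def quot_scale_def e(2) by blast
      then have "d \<in> span (E \<union> S)" using step.IH by blast
      then show "z \<in> span (E \<union> S)"
        unfolding z(1) using e(1) z(2,3) by (intro span_add span_scale) (simp_all add: span_base)
    qed
  qed
  moreover have "x \<in> (+) x ` S" for x
    using subspace_0[OF S] by (metis add_0_right image_eqI)
  moreover have "(+) x ` S \<in> quot_span scale S \<B>" for x
    using \<B>(3) quot_space_eq by blast
  ultimately have "span (E \<union> S) = UNIV" by blast
  then show "\<exists>E. finite E \<and> span (E \<union> S) = UNIV" using E by blast
next
  assume "\<exists>E. finite E \<and> span (E \<union> S) = UNIV"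
  then obtain E where E: "finite E" "span (E \<union> S) = UNIV" by blast
  let ?\<B> = "(\<lambda>x. (+) x ` S) ` E"
  have S_coset: "(+) s ` S = S" if "s \<in> S" for s
  proof -
    have "t \<in> (+) s ` S" if "t \<in> S" for t
      using S \<open>s \<in> S\<close> that by (intro image_eqI[of _ _ "t - s"] subspace_diff) auto
    then show ?thesis using S that subspace_add by blast
  qed
  have "D \<in> quot_space S" if "D \<in> quot_span scale S ?\<B>" for D
    using that
  proof induction
    case zero
    then show ?case using S_coset[OF subspace_0[OF S]] unfolding quot_space_eq by blast
  next
    case (step C D k)
    then show ?case
      unfolding quot_space_eq by (auto simp: quot_scale_coset quot_add_coset S)
  qed
  moreover have "(+) x ` S \<in> quot_span scale S ?\<B>" for x
  proof -
    obtain e s where x: "x = e + s" "e \<in> span E" "s \<in> S"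
      using E(2) span_Un[of E S] S span_eq_iff by blast
    have "(+) (e + s) ` S \<in> quot_span scale S ?\<B>" using x(2)
    proof (induction rule: span_induct_alt)
      case base
      then show ?case using S_coset[OF x(3)] quot_span.zero by simp
    next
      case (step c e y)
      then have "quot_add (quot_scale scale S c ((+) e ` S)) ((+) (y + s) ` S)
          \<in> quot_span scale S ?\<B>"
        by (intro quot_span.step) auto
      then show ?case by (simp only: quot_scale_coset[OF S] quot_add_coset[OF S] add.assoc[of "scale c e" y s])
    qed
    then show ?thesis using x by simp
  qed
  ultimately have "quot_span scale S ?\<B> = quot_space S" unfolding quot_space_eq by blast
  then show "quot_finite_dim scale S"
    unfolding quot_finite_dim_def using E(1) by (intro exI[of _ ?\<B>]) (auto simp: quot_space_eq)
qed

text \<open>Extend a basis of \<open>S\<close> by vectors of \<open>W\<close>. No added vector can lie in \<open>S\<close>, which is already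
  spanned; so a set \<open>W\<close> that exceeds \<open>S\<close> by finitely many vectors leads to a finite extension.\<close>

lemma basis_adapted_to_subspace:
  assumes "subspace S" "S \<subseteq> W"
  obtains B\<^sub>0 B where "B\<^sub>0 \<subseteq> B" "B \<subseteq> B\<^sub>0 \<union> (W - S)" "independent B" "span B\<^sub>0 = S" "W \<subseteq> span B"
proof -
  obtain B\<^sub>0 where B\<^sub>0: "B\<^sub>0 \<subseteq> S" "independent B\<^sub>0" "S \<subseteq> span B\<^sub>0"
    using maximal_independent_subset[of S] by metis
  then have sp: "span B\<^sub>0 = S" using assms(1) span_subspace by blast
  have "B\<^sub>0 \<subseteq> W" using B\<^sub>0(1) assms(2) by blast
  then obtain B where B: "B\<^sub>0 \<subseteq> B" "B \<subseteq> W" "independent B" "W \<subseteq> span B"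
    using maximal_independent_subset_extend[of B\<^sub>0 W] B\<^sub>0(2) by metis
  have "b \<notin> S" if b: "b \<in> B - B\<^sub>0" for b
  proof
    assume "b \<in> S"
    then have "b \<in> span (B - {b})" using sp span_mono[of B\<^sub>0 "B - {b}"] b B(1) by blast
    then show False using B(3) b unfolding dependent_def by blast
  qed
  then have "B \<subseteq> B\<^sub>0 \<union> (W - S)" using B(2) by blast
  with B(1) show thesis using B(3) sp B(4) by (rule that)
qed

end

section \<open>Functionals that vanish on the finite subspace\<close>

context extended_normed_space
begin

abbreviation X\<^sub>f\<^sub>i\<^sub>n :: "'a set" where "X\<^sub>f\<^sub>i\<^sub>n \<equiv> fin_subspace N"

sublocale functionals: vector_space_pair sc "(*) :: 'k \<Rightarrow> 'k \<Rightarrow> 'k"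
  by unfold_locales

abbreviation functional :: "('a \<Rightarrow> 'k) \<Rightarrow> bool"
  where "functional f \<equiv> Vector_Spaces.linear sc (*) f"

lemma functional_add: "functional f \<Longrightarrow> f (x + y) = f x + f y"
  by (rule functionals.linear_add)

lemma functional_scale: "functional f \<Longrightarrow> f (sc c x) = c * f x"
  by (rule functionals.linear_scale)

lemma functional_diff: "functional f \<Longrightarrow> f (x - y) = f x - f y"
  by (rule functionals.linear_diff)

lemma functional_sum: "functional f \<Longrightarrow> f (\<Sum>d\<in>D. sc (c d) d) = (\<Sum>d\<in>D. c d * f d)"
  by (simp add: functionals.linear_sum functional_scale)

lemma subspace_fin: "subspace X\<^sub>f\<^sub>i\<^sub>n"
  unfolding subspace_def
proof (intro conjI ballI allI)
  have "N 0 = 0" using ext_norm_eq_zero_iff by simp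
  then show "0 \<in> X\<^sub>f\<^sub>i\<^sub>n" by (simp add: fin_subspace_def)
  fix x y assume x: "x \<in> X\<^sub>f\<^sub>i\<^sub>n"
  show "sc c x \<in> X\<^sub>f\<^sub>i\<^sub>n" for c
    using x by (simp add: fin_subspace_def ext_norm_scale ennreal_mult_less_top)
  assume "y \<in> X\<^sub>f\<^sub>i\<^sub>n"
  then have "N x + N y < top" using x by (simp add: fin_subspace_def)
  then show "x + y \<in> X\<^sub>f\<^sub>i\<^sub>n"
    using ext_norm_triangle[of x y] by (simp add: fin_subspace_def le_less_trans)
qed

lemma in_fin_subspace: "N x < ennreal r \<Longrightarrow> x \<in> X\<^sub>f\<^sub>i\<^sub>n"
  by (auto simp: fin_subspace_def intro: less_trans)

lemma almost_conventional_iff: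
  "almost_conventional sc N \<longleftrightarrow> (\<exists>E. finite E \<and> span (E \<union> X\<^sub>f\<^sub>i\<^sub>n) = UNIV)"
  unfolding almost_conventional_def by (rule quot_finite_dim_iff[OF subspace_fin])

text \<open>The coordinates are those of a basis adapted to \<open>X\<^sub>f\<^sub>i\<^sub>n\<close>, restricted to the finitely many basis
  vectors \<open>D\<close> outside \<open>X\<^sub>f\<^sub>i\<^sub>n\<close>. Taking them as functionals that vanish on \<open>X\<^sub>f\<^sub>i\<^sub>n\<close> gives a projection
  to \<open>X\<^sub>f\<^sub>i\<^sub>n\<close> without choosing a complement as a set.\<close>

lemma coordinates_mod_fin:
  assumes "almost_conventional sc N"
  obtains D :: "'a set" and \<phi> where "finite D" "\<And>d. functional (\<phi> d)" "\<And>d x. d \<in> D \<Longrightarrow> x \<in> X\<^sub>f\<^sub>i\<^sub>n \<Longrightarrow> \<phi> d x = 0"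
    "\<And>x. x - (\<Sum>d\<in>D. sc (\<phi> d x) d) \<in> X\<^sub>f\<^sub>i\<^sub>n"
proof -
  obtain E where E: "finite E" "span (E \<union> X\<^sub>f\<^sub>i\<^sub>n) = UNIV"
    using assms almost_conventional_iff by blast
  obtain B\<^sub>0 B where B: "B\<^sub>0 \<subseteq> B" "B \<subseteq> B\<^sub>0 \<union> (E \<union> X\<^sub>f\<^sub>i\<^sub>n - X\<^sub>f\<^sub>i\<^sub>n)" "independent B" "span B\<^sub>0 = X\<^sub>f\<^sub>i\<^sub>n"
      "E \<union> X\<^sub>f\<^sub>i\<^sub>n \<subseteq> span B"
    by (rule basis_adapted_to_subspace[OF subspace_fin Un_upper2])
  define D where "D = B - B\<^sub>0"
  have D: "finite D" using B(2) E(1) unfolding D_def by (auto intro: finite_subset)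
  have span_B: "span B = UNIV" using B(5) E(2) span_minimal[OF B(5) subspace_span] by auto
  have "\<exists>f. functional f \<and> (\<forall>b\<in>B. f b = (if b = d then 1 else 0))" for d
    using functionals.linear_independent_extend[OF B(3)] .
  then obtain \<phi> where \<phi>: "\<And>d. functional (\<phi> d)" "\<And>d b. b \<in> B \<Longrightarrow> \<phi> d b = (if b = d then 1 else 0)"
    by metis
  have zero: "\<phi> d x = 0" if "d \<in> D" "x \<in> X\<^sub>f\<^sub>i\<^sub>n" for d x
  proof (rule functionals.linear_eq_0_on_span[OF \<phi>(1), of B\<^sub>0])
    show "\<phi> d b = 0" if "b \<in> B\<^sub>0" for b
      using that \<open>d \<in> D\<close> B(1) \<phi>(2)[of b d] by (auto simp: D_def)
  qed (use that B(4) in auto)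
  have "x - (\<Sum>d\<in>D. sc (\<phi> d x) d) \<in> X\<^sub>f\<^sub>i\<^sub>n" for x
  proof -
    have "x \<in> span B" using span_B by simp
    then show ?thesis
    proof (induction rule: span_induct_alt)
      case base
      then show ?case
        using subspace_0[OF subspace_fin] by (simp add: functionals.linear_0[OF \<phi>(1)])
    next
      case (step c b y)
      have "b - (\<Sum>d\<in>D. sc (\<phi> d b) d) \<in> X\<^sub>f\<^sub>i\<^sub>n"
      proof (cases "b \<in> D")
        case True
        then have "(\<Sum>d\<in>D. sc (\<phi> d b) d) = (\<Sum>d\<in>D. if b = d then d else 0)"
          using step(1) by (intro sum.cong) (auto simp: \<phi>(2))
        then show ?thesis using True D subspace_0[OF subspace_fin] by simp
      next
        case False
        then have "b \<in> X\<^sub>f\<^sub>i\<^sub>n" using step(1) B(4) span_base by (auto simp: D_def)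
        then show ?thesis using zero by (simp cong: sum.cong)
      qed
      then have "sc c (b - (\<Sum>d\<in>D. sc (\<phi> d b) d)) + (y - (\<Sum>d\<in>D. sc (\<phi> d y) d)) \<in> X\<^sub>f\<^sub>i\<^sub>n"
        using step.IH by (intro subspace_add subspace_scale subspace_fin)
      also have "sc c (b - (\<Sum>d\<in>D. sc (\<phi> d b) d)) + (y - (\<Sum>d\<in>D. sc (\<phi> d y) d))
          = sc c b + y - (\<Sum>d\<in>D. sc (\<phi> d (sc c b + y)) d)"
        by (simp add: functional_add functional_scale \<phi>(1) scale_left_distrib sum.distrib
            scale_right_diff_distrib scale_sum_right)
      finally show ?case .
    qed
  qed
  with D \<phi>(1) zero show thesis by (rule that)
qed

text \<open>The vectors \<open>m n\<close> belong to a basis adapted to \<open>X\<^sub>f\<^sub>i\<^sub>n\<close> and lie outside its part in \<open>X\<^sub>f\<^sub>i\<^sub>n\<close>, so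
  values on them can be chosen freely. The sequence is fixed before the values \<open>c\<close>: the values will
  be chosen in terms of it.\<close>

lemma prescribed_values_mod_fin:
  assumes "\<not> almost_conventional sc N"
  obtains m :: "nat \<Rightarrow> 'a"
  where "\<And>c. \<exists>f. functional f \<and> (\<forall>x\<in>X\<^sub>f\<^sub>i\<^sub>n. f x = 0) \<and> (\<forall>n. f (m n) = c n)"
proof -
  obtain B\<^sub>0 B where B: "B\<^sub>0 \<subseteq> B" "B \<subseteq> B\<^sub>0 \<union> (UNIV - X\<^sub>f\<^sub>i\<^sub>n)" "independent B" "span B\<^sub>0 = X\<^sub>f\<^sub>i\<^sub>n"
      "UNIV \<subseteq> span B"
    by (rule basis_adapted_to_subspace[OF subspace_fin subset_UNIV])
  have "infinite (B - B\<^sub>0)"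
  proof
    assume "finite (B - B\<^sub>0)"
    moreover have "B \<subseteq> (B - B\<^sub>0) \<union> X\<^sub>f\<^sub>i\<^sub>n" using B(4) span_superset[of B\<^sub>0] by blast
    then have "span B \<subseteq> span ((B - B\<^sub>0) \<union> X\<^sub>f\<^sub>i\<^sub>n)" by (rule span_mono)
    then have "span ((B - B\<^sub>0) \<union> X\<^sub>f\<^sub>i\<^sub>n) = UNIV" using B(5) by (simp add: top.extremum_unique)
    ultimately show False using assms almost_conventional_iff by blast
  qed
  then obtain m :: "nat \<Rightarrow> 'a" where m: "inj m" "range m \<subseteq> B - B\<^sub>0"
    using infinite_countable_subset by blast
  have "\<exists>f. functional f \<and> (\<forall>x\<in>X\<^sub>f\<^sub>i\<^sub>n. f x = 0) \<and> (\<forall>n. f (m n) = c n)" for c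
  proof -
    obtain f where f: "functional f"
        "\<And>b. b \<in> B \<Longrightarrow> f b = (if b \<in> range m then c (inv m b) else 0)"
      using functionals.linear_independent_extend[OF B(3),
          of "\<lambda>b. if b \<in> range m then c (inv m b) else 0"] by auto
    have "f x = 0" if "x \<in> X\<^sub>f\<^sub>i\<^sub>n" for x
    proof (rule functionals.linear_eq_0_on_span[OF f(1), of B\<^sub>0])
      show "f b = 0" if "b \<in> B\<^sub>0" for b
      proof -
        have "b \<in> B" "b \<notin> range m" using that m(2) B(1) by blast+
        then show ?thesis by (simp add: f(2))
      qed
    qed (use that B(4) in auto)
    moreover have "f (m n) = c n" for n
      using f(2)[of "m n"] m by auto
    ultimately show ?thesis using f(1) by blast
  qed
  then show thesis using that by blast
qed

text \<open>Finitely many vectors and \<open>X\<^sub>f\<^sub>i\<^sub>n\<close> span a proper subspace; \<open>f\<close> is the coordinate of a basis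
  vector outside that subspace.\<close>

lemma annihilator_of_finite_mod_fin:
  assumes "\<not> almost_conventional sc N" "finite E"
  obtains f where "functional f" "\<And>x. x \<in> X\<^sub>f\<^sub>i\<^sub>n \<Longrightarrow> f x = 0" "\<And>x. x \<in> E \<Longrightarrow> f x = 0" "f \<noteq> (\<lambda>x. 0)"
proof -
  let ?S = "span (E \<union> X\<^sub>f\<^sub>i\<^sub>n)"
  have ne: "?S \<noteq> UNIV" using assms almost_conventional_iff by blast
  obtain B\<^sub>0 B where B: "B\<^sub>0 \<subseteq> B" "B \<subseteq> B\<^sub>0 \<union> (UNIV - ?S)" "independent B" "span B\<^sub>0 = ?S"
      "UNIV \<subseteq> span B"
    by (rule basis_adapted_to_subspace[OF subspace_span subset_UNIV])
  have "\<not> B \<subseteq> B\<^sub>0"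
  proof
    assume "B \<subseteq> B\<^sub>0"
    then have "span B \<subseteq> ?S" using span_mono B(4) by metis
    then show False using B(5) ne by (metis subset_antisym subset_UNIV order_trans)
  qed
  then obtain b where b: "b \<in> B" "b \<notin> B\<^sub>0" by blast
  obtain f where f: "functional f" "\<forall>x\<in>B. f x = (if x = b then 1 else 0)"
    using functionals.linear_independent_extend[OF B(3), of "\<lambda>x. if x = b then 1 else 0"] by auto
  have "f x = 0" if "x \<in> ?S" for x
  proof (rule functionals.linear_eq_0_on_span[OF f(1), of B\<^sub>0])
    show "f x = 0" if "x \<in> B\<^sub>0" for x
      using that f(2) B(1) b by auto
  qed (use that B(4) in auto)
  moreover have "f b = 1" using f(2) b by simp
  ultimately show thesis using f(1) by (intro that[of f]) (auto intro: span_base)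
qed

end


section \<open>Continuity for the extended norm\<close>

context extended_normed_space
begin

text \<open>Truncating the norm at 1 does not affect balls of radius at most 1, so the topology can be
  described by the extended norm directly.\<close>

lemma openin_ext_topology_iff:
  "openin (ext_topology N) U \<longleftrightarrow> (\<forall>x\<in>U. \<exists>e>0. \<forall>y. N (y - x) < ennreal e \<longrightarrow> y \<in> U)"
proof -
  interpret d: Metric_space UNIV "ext_dist N" by (rule Metric_space_ext_dist)
  have small: "ext_dist N x y < e \<longleftrightarrow> N (y - x) < ennreal e" if "0 < e" "e \<le> 1" for x y e
  proof -
    have "N (x - y) = N (y - x)" using ext_norm_minus[of "x - y"] by simp
    moreover have "enn2real (min 1 a) < e \<longleftrightarrow> a < ennreal e" for a
    proof (cases a)
      case (real r)
      have "min 1 (ennreal r) = ennreal (min 1 r)"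
        by (metis ennreal_1 min_of_mono mono_def ennreal_leI)
      then show ?thesis using real that by (auto simp: ennreal_less_iff min_def)
    next
      case top
      then show ?thesis using that by simp
    qed
    ultimately show ?thesis by (simp add: ext_dist_def)
  qed
  have "(\<exists>r>0. d.mball x r \<subseteq> U) \<longleftrightarrow> (\<exists>e>0. \<forall>y. N (y - x) < ennreal e \<longrightarrow> y \<in> U)" for x
  proof
    assume "\<exists>r>0. d.mball x r \<subseteq> U"
    then obtain r where r: "r > 0" "d.mball x r \<subseteq> U" by blast
    have "y \<in> U" if "N (y - x) < ennreal (min r 1)" for y
      using that small[of "min r 1" x y] r by auto
    then show "\<exists>e>0. \<forall>y. N (y - x) < ennreal e \<longrightarrow> y \<in> U"
      using r(1) by (intro exI[of _ "min r 1"]) auto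
  next
    assume "\<exists>e>0. \<forall>y. N (y - x) < ennreal e \<longrightarrow> y \<in> U"
    then obtain e where e: "e > 0" "\<And>y. N (y - x) < ennreal e \<Longrightarrow> y \<in> U" by blast
    have "y \<in> U" if "y \<in> d.mball x (min e 1)" for y
    proof (rule e(2))
      have "N (y - x) < ennreal (min e 1)"
        using that small[of "min e 1" x y] e(1) by auto
      also have "\<dots> \<le> ennreal e" by (rule ennreal_leI) simp
      finally show "N (y - x) < ennreal e" .
    qed
    then show "\<exists>r>0. d.mball x r \<subseteq> U"
      using e(1) by (intro exI[of _ "min e 1"]) auto
  qed
  then show ?thesis
    unfolding ext_topology_def d.openin_mtopology by blast
qed

lemma ext_nbhd_0:
  assumes "openin (ext_topology N) U" "0 \<in> U"
  obtains e where "e > 0" "\<forall>y. N y < ennreal e \<longrightarrow> y \<in> U"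
proof -
  have "\<exists>e>0. \<forall>y. N (y - 0) < ennreal e \<longrightarrow> y \<in> U"
    using assms(1)[unfolded openin_ext_topology_iff] assms(2) by (rule bspec)
  then show thesis using that by auto
qed

lemma topspace_ext_topology [simp]: "topspace (ext_topology N) = UNIV"
  unfolding ext_topology_def by (simp add: Metric_space.topspace_mtopology[OF Metric_space_ext_dist])

lemma seminorm_UNIV_0: "seminorm_on sc UNIV p \<Longrightarrow> p 0 = 0"
  using seminorm_on_scale[of sc UNIV p 0 0] by simp

lemma seminorm_family_UNIV:
  assumes "\<And>p. p \<in> P \<Longrightarrow> seminorm_on sc UNIV p"
  shows "seminorm_family sc UNIV P"
  using assms by unfold_locales auto

lemma seminorm_norm_functional:
  assumes "functional f"
  shows "seminorm_on sc UNIV (\<lambda>x. norm (f x))"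
  using assms
  by (simp add: seminorm_on_def functional_add functional_scale norm_mult norm_triangle_ineq)

text \<open>Scale \<open>x\<close> to norm \<open>\<delta> / 2\<close>; this is possible exactly because the norm of \<open>x\<close> is finite.\<close>

lemma seminorm_bound_of_ball_bound:
  assumes p: "seminorm_on sc UNIV p" and \<delta>: "0 < \<delta>"
    and ball: "\<And>y. N y < ennreal \<delta> \<Longrightarrow> p y \<le> K" and x: "x \<in> X\<^sub>f\<^sub>i\<^sub>n"
  shows "p x \<le> 2 * K / \<delta> * enn2real (N x)"
proof (cases "x = 0")
  case True
  then have "N x = 0" using ext_norm_eq_zero_iff by simp
  then show ?thesis using True by (simp add: seminorm_UNIV_0[OF p])
next
  case False
  define r where "r = enn2real (N x)"
  have Nx: "N x = ennreal r" using x by (simp add: r_def fin_subspace_def)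
  have r: "0 < r"
    using False ext_norm_eq_zero_iff[of x] Nx by (metis ennreal_neg not_le)
  define t where "t = \<delta> / (2 * r)"
  have t: "0 < t" using r \<delta> by (simp add: t_def)
  have "N (sc (of_real t) x) = ennreal (t * r)"
    using t r by (simp add: ext_norm_scale Nx ennreal_mult)
  also have "t * r = \<delta> / 2" using r by (simp add: t_def)
  finally have "N (sc (of_real t) x) < ennreal \<delta>" using \<delta> by (simp add: ennreal_less_iff)
  then have "t * p x \<le> K"
    using ball seminorm_on_scale[OF p, of x "of_real t"] t by fastforce
  then have "p x \<le> K / t" using t by (simp add: field_simps)
  then show ?thesis using r by (simp add: t_def r_def mult_ac)
qed

text \<open>A seminorm is continuous iff it is bounded near 0, and a ball around 0 with finite radius
  lies in \<open>X\<^sub>f\<^sub>i\<^sub>n\<close>. So vectors of infinite norm impose no condition.\<close>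

lemma ext_cont_seminorm_iff:
  assumes p: "seminorm_on sc UNIV p"
  shows "coarser (seminorm_topology UNIV {p}) (ext_topology N) \<longleftrightarrow>
    (\<exists>C. \<forall>x\<in>X\<^sub>f\<^sub>i\<^sub>n. p x \<le> C * enn2real (N x))"
proof
  assume c: "coarser (seminorm_topology UNIV {p}) (ext_topology N)"
  have "seminorm_family sc UNIV {p}" by (rule seminorm_family_UNIV) (use p in simp)
  then have "openin (seminorm_topology UNIV {p}) {y \<in> UNIV. p y < 1}"
    by (rule seminorm_family.openin_unit_ball) simp
  then have "openin (ext_topology N) {y. p y < 1}" using c by (simp add: coarser_def)
  moreover have "0 \<in> {y. p y < 1}" by (simp add: seminorm_UNIV_0[OF p])
  ultimately obtain e where e: "e > 0" "\<forall>y. N y < ennreal e \<longrightarrow> y \<in> {y. p y < 1}"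
    by (rule ext_nbhd_0)
  have "p x \<le> 2 * 1 / e * enn2real (N x)" if "x \<in> X\<^sub>f\<^sub>i\<^sub>n" for x
    using e(2) by (intro seminorm_bound_of_ball_bound[OF p e(1) _ that]) (simp add: less_imp_le)
  then show "\<exists>C. \<forall>x\<in>X\<^sub>f\<^sub>i\<^sub>n. p x \<le> C * enn2real (N x)" by blast
next
  assume "\<exists>C. \<forall>x\<in>X\<^sub>f\<^sub>i\<^sub>n. p x \<le> C * enn2real (N x)"
  then obtain C where C: "\<And>x. x \<in> X\<^sub>f\<^sub>i\<^sub>n \<Longrightarrow> p x \<le> C * enn2real (N x)" by blast
  have "openin (ext_topology N) {y. p (y - x) < e}" for x e
    unfolding openin_ext_topology_iff
  proof (intro ballI)
    fix z assume z: "z \<in> {y. p (y - x) < e}"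
    define d where "d = (e - p (z - x)) / (1 + \<bar>C\<bar>)"
    have d: "0 < d" using z by (simp add: d_def)
    have "p (y - x) < e" if y: "N (y - z) < ennreal d" for y
    proof -
      have fin: "y - z \<in> X\<^sub>f\<^sub>i\<^sub>n" using y by (rule in_fin_subspace)
      have lt: "enn2real (N (y - z)) < d"
        using y d fin by (cases "N (y - z)") (auto simp: ennreal_less_iff)
      have "p (y - z) \<le> C * enn2real (N (y - z))" by (rule C[OF fin])
      also have "\<dots> \<le> (1 + \<bar>C\<bar>) * enn2real (N (y - z))"
        by (rule mult_right_mono) auto
      also have "\<dots> < (1 + \<bar>C\<bar>) * d" using lt by (intro mult_strict_left_mono) auto
      also have "\<dots> = e - p (z - x)" by (simp add: d_def)
      finally show ?thesis using seminorm_on_triangle[OF p, of "y - z" "z - x"] by simp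
    qed
    then show "\<exists>e'>0. \<forall>y. N (y - z) < ennreal e' \<longrightarrow> y \<in> {y. p (y - x) < e}" using d by blast
  qed
  moreover have "openin (ext_topology N) UNIV"
    by (metis topspace_ext_topology openin_topspace)
  ultimately show "coarser (seminorm_topology UNIV {p}) (ext_topology N)"
    by (intro coarser_seminorm_topology_singleton) simp_all
qed

text \<open>A functional \<open>f\<close> is continuous iff the seminorm \<open>norm (f x)\<close> is: the preimage of a ball around
  \<open>f x\<close> is the ball of this seminorm around \<open>x\<close> with the same radius.\<close>

lemma cont_dual_iff:
  "f \<in> cont_dual sc N \<longleftrightarrow>
    functional f \<and> (\<exists>C. \<forall>x\<in>X\<^sub>f\<^sub>i\<^sub>n. norm (f x) \<le> C * enn2real (N x))"
proof (cases "functional f")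
  case f: True
  let ?p = "\<lambda>x. norm (f x)"
  note p = seminorm_norm_functional[OF f]
  have "continuous_map (ext_topology N) euclidean f \<longleftrightarrow>
      coarser (seminorm_topology UNIV {?p}) (ext_topology N)"
  proof
    assume "continuous_map (ext_topology N) euclidean f"
    then have pre: "openin (ext_topology N) {x. f x \<in> W}" if "open W" for W
      using that by (simp add: continuous_map_def)
    have "openin (ext_topology N) {y. norm (f (y - x)) < e}" for x e
      using pre[of "ball (f x) e"] by (simp add: functional_diff[OF f] dist_norm norm_minus_commute)
    moreover have "openin (ext_topology N) UNIV"
      by (metis topspace_ext_topology openin_topspace)
    ultimately show "coarser (seminorm_topology UNIV {?p}) (ext_topology N)"
      by (intro coarser_seminorm_topology_singleton) simp_all
  next
    assume c: "coarser (seminorm_topology UNIV {?p}) (ext_topology N)"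
    interpret seminorm_family sc UNIV "{?p}"
      by (rule seminorm_family_UNIV) (use p in simp)
    have "openin (ext_topology N) {x. f x \<in> W}" if W: "open W" for W
    proof -
      have "\<exists>Q e. finite Q \<and> Q \<subseteq> {?p} \<and> 0 < e \<and>
          seminorm_ball UNIV Q x e \<subseteq> {x. f x \<in> W}" if "f x \<in> W" for x
      proof -
        obtain e where e: "e > 0" "ball (f x) e \<subseteq> W" by (rule openE[OF W \<open>f x \<in> W\<close>])
        have "f y \<in> W" if "norm (f (y - x)) < e" for y
          using e(2) that
          by (intro subsetD[OF e(2)]) (simp add: functional_diff[OF f] dist_norm norm_minus_commute)
        then have "seminorm_ball UNIV {?p} x e \<subseteq> {x. f x \<in> W}"
          by (auto simp: seminorm_ball_def)
        then show ?thesis using e(1) by (intro exI[of _ "{?p}"] exI[of _ e]) simp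
      qed
      then have "openin (seminorm_topology UNIV {?p}) {x. f x \<in> W}"
        unfolding openin_seminorm_topology_iff by simp
      then show ?thesis using c by (simp add: coarser_def)
    qed
    then show "continuous_map (ext_topology N) euclidean f" by (simp add: continuous_map_def)
  qed
  then show ?thesis using f ext_cont_seminorm_iff[OF p] by (simp add: cont_dual_def)
qed (simp add: cont_dual_def)

lemma cont_dual_bound:
  assumes "f \<in> cont_dual sc N"
  obtains C where "0 \<le> C" "\<And>x. x \<in> X\<^sub>f\<^sub>i\<^sub>n \<Longrightarrow> norm (f x) \<le> C * enn2real (N x)"
proof -
  obtain C where C: "\<And>x. x \<in> X\<^sub>f\<^sub>i\<^sub>n \<Longrightarrow> norm (f x) \<le> C * enn2real (N x)"
    using assms cont_dual_iff by blast
  have "norm (f x) \<le> \<bar>C\<bar> * enn2real (N x)" if "x \<in> X\<^sub>f\<^sub>i\<^sub>n" for x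
    using C[OF that] mult_right_mono[OF abs_ge_self[of C], of "enn2real (N x)"] by simp
  then show thesis using that[of "\<bar>C\<bar>"] by auto
qed

lemma zero_on_fin_in_cont_dual:
  "functional f \<Longrightarrow> (\<And>x. x \<in> X\<^sub>f\<^sub>i\<^sub>n \<Longrightarrow> f x = 0) \<Longrightarrow> f \<in> cont_dual sc N"
  by (auto simp: cont_dual_iff intro!: exI[of _ 0])

lemma functional_cont_dual: "f \<in> cont_dual sc N \<Longrightarrow> functional f"
  by (simp add: cont_dual_def)

lemma cont_dual_zero: "0 \<in> cont_dual sc N"
  by (rule zero_on_fin_in_cont_dual) (auto simp: zero_fun_def functionals.linear_zero)

lemma cont_dual_diff:
  assumes f: "f \<in> cont_dual sc N" and g: "g \<in> cont_dual sc N"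
  shows "f - g \<in> cont_dual sc N"
proof -
  obtain C where C: "\<And>x. x \<in> X\<^sub>f\<^sub>i\<^sub>n \<Longrightarrow> norm (f x) \<le> C * enn2real (N x)"
    using cont_dual_bound[OF f] by blast
  obtain K where K: "\<And>x. x \<in> X\<^sub>f\<^sub>i\<^sub>n \<Longrightarrow> norm (g x) \<le> K * enn2real (N x)"
    using cont_dual_bound[OF g] by blast
  have "functional (f - g)"
    using functionals.linear_compose_sub[OF functional_cont_dual[OF f] functional_cont_dual[OF g]]
    by (simp add: fun_diff_def)
  moreover have "norm ((f - g) x) \<le> (C + K) * enn2real (N x)" if "x \<in> X\<^sub>f\<^sub>i\<^sub>n" for x
    using norm_triangle_ineq4[of "f x" "g x"] C[OF that] K[OF that] by (simp add: algebra_simps)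
  ultimately show ?thesis using cont_dual_iff by blast
qed


section \<open>The finest locally convex topology\<close>

text \<open>The norm \<open>q\<close> is the given norm on the component in \<open>X\<^sub>f\<^sub>i\<^sub>n\<close> plus the sum norm of the
  coordinates. It agrees with the given norm on \<open>X\<^sub>f\<^sub>i\<^sub>n\<close>, hence is continuous, and it dominates each
  continuous seminorm \<open>p\<close>, because \<open>p\<close> is at most a multiple of the norm on \<open>X\<^sub>f\<^sub>i\<^sub>n\<close> and \<open>D\<close> is
  finite.\<close>

lemma almost_conventional_imp_normable_flc:
  assumes "almost_conventional sc N"
  shows "normable sc UNIV (flc_topology sc N)"
proof -
  obtain D :: "'a set" and \<phi> where D: "finite D"
    and \<phi>: "\<And>d. functional (\<phi> d)" "\<And>d x. d \<in> D \<Longrightarrow> x \<in> X\<^sub>f\<^sub>i\<^sub>n \<Longrightarrow> \<phi> d x = 0"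
    and fin: "\<And>x. x - (\<Sum>d\<in>D. sc (\<phi> d x) d) \<in> X\<^sub>f\<^sub>i\<^sub>n"
    using coordinates_mod_fin[OF assms] by blast
  define b where "b x = x - (\<Sum>d\<in>D. sc (\<phi> d x) d)" for x
  have b_fin: "b x \<in> X\<^sub>f\<^sub>i\<^sub>n" for x using fin by (simp add: b_def)
  have b_add: "b (x + y) = b x + b y" for x y
    by (simp add: b_def functional_add \<phi>(1) scale_left_distrib sum.distrib)
  have b_scale: "b (sc c x) = sc c (b x)" for c x
    by (simp add: b_def functional_scale \<phi>(1) scale_right_diff_distrib scale_sum_right)
  define q where "q x = enn2real (N (b x)) + (\<Sum>d\<in>D. norm (\<phi> d x))" for x
  have q: "seminorm_on sc UNIV q"
    unfolding seminorm_on_def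
  proof (intro conjI ballI allI)
    fix x y c
    show "0 \<le> q x" by (simp add: q_def sum_nonneg)
    show "q (sc c x) = norm c * q x"
      by (simp add: q_def b_scale ext_norm_scale enn2real_mult functional_scale \<phi>(1) norm_mult
          sum_distrib_left distrib_left)
    have "enn2real (N (b x + b y)) \<le> enn2real (N (b x) + N (b y))"
      using b_fin[of x] b_fin[of y]
      by (intro enn2real_mono ext_norm_triangle) (simp add: fin_subspace_def)
    also have "\<dots> = enn2real (N (b x)) + enn2real (N (b y))"
      using b_fin[of x] b_fin[of y] by (simp add: fin_subspace_def enn2real_plus)
    finally have 1: "enn2real (N (b x + b y)) \<le> enn2real (N (b x)) + enn2real (N (b y))" .
    have "(\<Sum>d\<in>D. norm (\<phi> d (x + y))) \<le> (\<Sum>d\<in>D. norm (\<phi> d x) + norm (\<phi> d y))"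
      by (intro sum_mono) (simp add: functional_add \<phi>(1) norm_triangle_ineq)
    then show "q (x + y) \<le> q x + q y"
      using 1 by (simp add: q_def b_add sum.distrib)
  qed
  have q_zero: "x = 0" if "q x = 0" for x
  proof -
    have "enn2real (N (b x)) \<ge> 0" "(\<Sum>d\<in>D. norm (\<phi> d x)) \<ge> 0" by (auto intro: sum_nonneg)
    then have "enn2real (N (b x)) = 0" and s: "(\<Sum>d\<in>D. norm (\<phi> d x)) = 0"
      using that unfolding q_def by linarith+
    then have "N (b x) = 0" using b_fin[of x] by (auto simp: enn2real_eq_0_iff fin_subspace_def)
    then have "b x = 0" using ext_norm_eq_zero_iff by blast
    moreover have "\<phi> d x = 0" if "d \<in> D" for d
      using s that D by (simp add: sum_nonneg_eq_0_iff)
    then have "b x = x" unfolding b_def by simp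
    ultimately show "x = 0" by simp
  qed
  have q_fin: "q x = enn2real (N x)" if "x \<in> X\<^sub>f\<^sub>i\<^sub>n" for x
    using \<phi>(2)[OF _ that] by (simp add: q_def b_def)
  have dominates: "\<exists>K. \<forall>x\<in>UNIV. p x \<le> K * q x"
    if p: "seminorm_on sc UNIV p" "coarser (seminorm_topology UNIV {p}) (ext_topology N)" for p
  proof -
    obtain C where C: "\<And>x. x \<in> X\<^sub>f\<^sub>i\<^sub>n \<Longrightarrow> p x \<le> C * enn2real (N x)"
      using p ext_cont_seminorm_iff by blast
    define K where "K = \<bar>C\<bar> + (\<Sum>d\<in>D. p d)"
    have p_nonneg: "0 \<le> p x" for x using seminorm_on_nonneg[OF p(1)] by simp
    have p_sum: "p (\<Sum>d\<in>D'. sc (c d) d) \<le> (\<Sum>d\<in>D'. norm (c d) * p d)" if "finite D'" for c D'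
      using that
    proof induction
      case empty
      then show ?case by (simp add: seminorm_UNIV_0[OF p(1)])
    next
      case (insert d D')
      then show ?case
        using seminorm_on_triangle[OF p(1), of "sc (c d) d" "\<Sum>d\<in>D'. sc (c d) d"]
          seminorm_on_scale[OF p(1), of d "c d"] by simp
    qed
    have "p x \<le> K * q x" for x
    proof -
      have "p x = p (b x + (\<Sum>d\<in>D. sc (\<phi> d x) d))" by (simp add: b_def)
      also have "\<dots> \<le> p (b x) + p (\<Sum>d\<in>D. sc (\<phi> d x) d)"
        by (rule seminorm_on_triangle[OF p(1)]) auto
      also have "\<dots> \<le> \<bar>C\<bar> * enn2real (N (b x)) + (\<Sum>d\<in>D. norm (\<phi> d x) * p d)"
        using C[OF b_fin[of x]] p_sum[OF D, of "\<lambda>d. \<phi> d x"]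
          mult_right_mono[OF abs_ge_self[of C], of "enn2real (N (b x))"] by simp
      also have "(\<Sum>d\<in>D. norm (\<phi> d x) * p d) \<le> (\<Sum>d\<in>D. q x * p d)"
      proof (intro sum_mono mult_right_mono p_nonneg)
        fix d assume "d \<in> D"
        then have "norm (\<phi> d x) \<le> (\<Sum>d\<in>D. norm (\<phi> d x))" using D by (intro member_le_sum) auto
        then show "norm (\<phi> d x) \<le> q x" unfolding q_def by (simp add: add_increasing)
      qed
      also have "\<bar>C\<bar> * enn2real (N (b x)) \<le> \<bar>C\<bar> * q x"
        unfolding q_def by (intro mult_left_mono) (simp_all add: sum_nonneg)
      finally show ?thesis by (simp add: K_def distrib_left distrib_right sum_distrib_left mult.commute)
    qed
    then show ?thesis by blast
  qed
  have "is_flc_topology sc N (seminorm_topology UNIV {q})"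
    unfolding is_flc_topology_def
  proof (intro conjI allI impI)
    show "locally_convex_topology sc UNIV (seminorm_topology UNIV {q})"
      unfolding locally_convex_topology_def using q by (intro exI[of _ "{q}"]) simp
    show "coarser (seminorm_topology UNIV {q}) (ext_topology N)"
      using ext_cont_seminorm_iff[OF q] q_fin by (metis mult_1 order_refl)
    fix T' assume T': "locally_convex_topology sc UNIV T' \<and> coarser T' (ext_topology N)"
    then obtain P where P: "\<And>p. p \<in> P \<Longrightarrow> seminorm_on sc UNIV p" "T' = seminorm_topology UNIV P"
      by (auto simp: locally_convex_topology_def)
    interpret seminorm_family sc UNIV P by (rule seminorm_family_UNIV) (rule P(1))
    show "coarser T' (seminorm_topology UNIV {q})"
      unfolding P(2)
    proof (rule coarser_seminorm_topology_dominated[OF q dominates[OF P(1)]])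
      fix p assume "p \<in> P"
      then have "coarser (seminorm_topology UNIV {p}) T'"
        unfolding P(2) by (intro coarser_seminorm_topology_mono) simp
      then show "coarser (seminorm_topology UNIV {p}) (ext_topology N)"
        using T' coarser_trans by blast
    qed
  qed
  then have "flc_topology sc N = seminorm_topology UNIV {q}"
    using is_flc_topology_ex1 is_flc_topology_flc_topology by blast
  then show ?thesis using q q_zero by (auto simp: normable_def norm_on_def)
qed

text \<open>Take vectors \<open>m n\<close> on which functionals that vanish on \<open>X\<^sub>f\<^sub>i\<^sub>n\<close> have free values. Every
  neighbourhood of 0 in a locally convex topology is absorbing, so a metric would allow to scale
  \<open>m n\<close> by some \<open>t n > 0\<close> into the ball of radius \<open>1 / (n + 1)\<close>. The functional \<open>f\<close> with value 1 on all
  scaled vectors and 0 on \<open>X\<^sub>f\<^sub>i\<^sub>n\<close> is continuous for the finest locally convex topology, although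
  these vectors converge to 0.\<close>

lemma metrizable_flc_imp_almost_conventional:
  assumes "metrizable_space (flc_topology sc N)"
  shows "almost_conventional sc N"
proof (rule ccontr)
  assume "\<not> almost_conventional sc N"
  then obtain m :: "nat \<Rightarrow> 'a"
    where m: "\<And>c. \<exists>f. functional f \<and> (\<forall>x\<in>X\<^sub>f\<^sub>i\<^sub>n. f x = 0) \<and> (\<forall>n. f (m n) = c n)"
    using prescribed_values_mod_fin by blast
  let ?T = "flc_topology sc N"
  have flc: "is_flc_topology sc N ?T" by (rule is_flc_topology_flc_topology)
  then obtain P where P: "\<And>p. p \<in> P \<Longrightarrow> seminorm_on sc UNIV p" "?T = seminorm_topology UNIV P"
    by (auto simp: is_flc_topology_def locally_convex_topology_def)
  interpret P: seminorm_family sc UNIV P by (rule seminorm_family_UNIV) (rule P(1))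
  have absorbing: "\<exists>t>0. sc (of_real t) x \<in> U" if U: "openin ?T U" "0 \<in> U" for U x
  proof -
    obtain Q e where Q: "finite Q" "Q \<subseteq> P" "0 < e" "\<forall>y\<in>UNIV. (\<forall>p\<in>Q. p y < e) \<longrightarrow> y \<in> U"
      using U unfolding P(2) by (rule P.nbhd_0_contains_ball)
    define s where "s = 1 + (\<Sum>p\<in>Q. p x)"
    have nonneg: "0 \<le> p x" if "p \<in> Q" for p
      using that Q(2) seminorm_on_nonneg[OF P(1)] by blast
    then have s: "0 < s" by (simp add: s_def add_pos_nonneg sum_nonneg)
    have "p (sc (of_real (e / s)) x) < e" if p: "p \<in> Q" for p
    proof -
      have "p x \<le> (\<Sum>p\<in>Q. p x)" using p Q(1) nonneg by (intro member_le_sum) auto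
      then have "p x < s" by (simp add: s_def)
      then have "e / s * p x < e" using s Q(3) by (simp add: field_simps)
      moreover have "p (sc (of_real (e / s)) x) = e / s * p x"
        using seminorm_on_scale[OF P(1), of p x "of_real (e / s)"] subsetD[OF Q(2) p] Q(3) s
        by (simp add: norm_divide)
      ultimately show ?thesis by simp
    qed
    then show ?thesis using Q(3,4) s by (intro exI[of _ "e / s"]) simp
  qed
  obtain M d where Md: "Metric_space M d" "?T = Metric_space.mtopology M d"
    using assms metrizable_space_def by metis
  interpret d: Metric_space M d by (rule Md(1))
  have "openin ?T UNIV"
    unfolding P(2) P.openin_seminorm_topology_iff by (auto intro!: exI[of _ "{}"] exI[of _ "1::real"])
  then have "UNIV \<subseteq> topspace ?T" by (rule openin_subset)
  then have M: "M = UNIV" unfolding Md(2) d.topspace_mtopology by (simp add: top.extremum_unique)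
  have "\<exists>t>0. sc (of_real t) (m n) \<in> d.mball 0 (1 / real (Suc n))" for n
  proof (rule absorbing)
    show "openin ?T (d.mball 0 (1 / real (Suc n)))" unfolding Md(2) by (rule d.openin_mball)
    show "0 \<in> d.mball 0 (1 / real (Suc n))" using M by (intro d.centre_in_mball_iff[THEN iffD2]) simp
  qed
  then obtain t where t: "\<And>n. t n > 0" "\<And>n. sc (of_real (t n)) (m n) \<in> d.mball 0 (1 / real (Suc n))"
    by metis
  obtain f where f: "functional f" "\<And>x. x \<in> X\<^sub>f\<^sub>i\<^sub>n \<Longrightarrow> f x = 0" "\<And>n. f (m n) = 1 / of_real (t n)"
    using m[of "\<lambda>n. 1 / of_real (t n)"] by blast
  let ?p = "\<lambda>x. norm (f x)"
  note p = seminorm_norm_functional[OF f(1)]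
  have "coarser (seminorm_topology UNIV {?p}) (ext_topology N)"
    using ext_cont_seminorm_iff[OF p] f(2) by (auto intro!: exI[of _ 0])
  moreover have "locally_convex_topology sc UNIV (seminorm_topology UNIV {?p})"
    unfolding locally_convex_topology_def using p by (intro exI[of _ "{?p}"]) simp
  ultimately have "coarser (seminorm_topology UNIV {?p}) ?T"
    using flc by (simp add: is_flc_topology_def)
  moreover have "seminorm_family sc UNIV {?p}" by (rule seminorm_family_UNIV) (use p in simp)
  then have "openin (seminorm_topology UNIV {?p}) {y \<in> UNIV. ?p y < 1}"
    by (rule seminorm_family.openin_unit_ball) simp
  ultimately have "openin ?T {y. norm (f y) < 1}" by (simp add: coarser_def)
  then have "\<forall>x. x \<in> {y. norm (f y) < 1} \<longrightarrow> (\<exists>r>0. d.mball x r \<subseteq> {y. norm (f y) < 1})"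
    unfolding Md(2) d.openin_mtopology by (rule conjunct2)
  moreover have "0 \<in> {y. norm (f y) < 1}" by (simp add: functionals.linear_0[OF f(1)])
  ultimately obtain r where r: "r > 0" "d.mball 0 r \<subseteq> {y. norm (f y) < 1}" by blast
  obtain n where "1 / real (Suc n) < r" using r(1) by (rule nat_approx_posE)
  then have "sc (of_real (t n)) (m n) \<in> d.mball 0 r" using t(2)[of n] by auto
  then have "norm (f (sc (of_real (t n)) (m n))) < 1" using r(2) by blast
  moreover have "f (sc (of_real (t n)) (m n)) = 1"
    using t(1)[of n] by (simp add: functional_scale f(1,3))
  ultimately show False by simp
qed

end


section \<open>Uniform convergence on bounded sets\<close>

context extended_normed_space
begin

text \<open>It suffices to test the unit ball, since every neighbourhood of 0 contains a multiple of it.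
  So a bounded set is covered by finitely many balls of a common finite radius.\<close>

lemma ext_bounded_iff:
  "ext_bounded sc N A \<longleftrightarrow>
    (\<exists>r F. 0 < r \<and> finite F \<and> F \<subseteq> A \<and> (\<forall>x\<in>A. \<exists>a\<in>F. N (x - a) < ennreal r))"
proof
  assume A: "ext_bounded sc N A"
  let ?U = "{u. N u < ennreal 1}"
  have "openin (ext_topology N) ?U"
    unfolding openin_ext_topology_iff
  proof
    fix x assume x: "x \<in> ?U"
    define s where "s = enn2real (N x)"
    have "N x < top" using x by (auto intro: less_trans)
    then have s: "N x = ennreal s" "0 \<le> s" by (simp_all add: s_def)
    then have "s < 1" using x by (simp add: ennreal_less_iff flip: ennreal_1)
    have "N y < ennreal 1" if "N (y - x) < ennreal (1 - s)" for y
    proof -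
      obtain u where u: "N (y - x) = ennreal u" "0 \<le> u"
        using \<open>N (y - x) < ennreal (1 - s)\<close> by (cases "N (y - x)") auto
      then have "u + s < 1" using \<open>N (y - x) < ennreal (1 - s)\<close> by (simp add: ennreal_less_iff)
      have "N y \<le> N (y - x) + N x" using ext_norm_triangle[of "y - x" x] by simp
      also have "\<dots> = ennreal (u + s)" using u s by simp
      also have "\<dots> < ennreal 1" using u s \<open>u + s < 1\<close> by (intro ennreal_lessI) simp_all
      finally show ?thesis .
    qed
    then show "\<exists>e>0. \<forall>y. N (y - x) < ennreal e \<longrightarrow> y \<in> ?U"
      using \<open>s < 1\<close> by (intro exI[of _ "1 - s"]) simp
  qed
  moreover have "0 \<in> ?U" using ext_norm_eq_zero_iff[of 0] by simp
  ultimately have "\<exists>W. openin (ext_topology N) W \<and> 0 \<in> W \<and> W \<subseteq> ?U" by blast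
  then have "\<exists>r::real. 0 < r \<and> (\<exists>F. finite F \<and> F \<subseteq> A \<and>
      A \<subseteq> {a + sc (of_real r) u | a u. a \<in> F \<and> u \<in> ?U})"
    by (rule A[unfolded ext_bounded_def, rule_format])
  then obtain r F where r: "0 < r" "finite F" "F \<subseteq> A"
      "A \<subseteq> {a + sc (of_real r) u | a u. a \<in> F \<and> u \<in> ?U}"
    by (elim exE conjE) (rule that)
  have "\<exists>a\<in>F. N (x - a) < ennreal r" if "x \<in> A" for x
  proof -
    obtain a u where u: "x = a + sc (of_real r) u" "a \<in> F" "N u < ennreal 1" using r(4) \<open>x \<in> A\<close> by blast
    have "ennreal r * N u < ennreal r * ennreal 1"
      using r(1) u(3) by (intro ennreal_mult_strict_left_mono) auto
    then show ?thesis using u r(1) by (intro bexI[of _ a]) (auto simp: ext_norm_scale)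
  qed
  then show "\<exists>r F. 0 < r \<and> finite F \<and> F \<subseteq> A \<and> (\<forall>x\<in>A. \<exists>a\<in>F. N (x - a) < ennreal r)"
    using r by (intro exI[of _ r] exI[of _ F]) simp
next
  assume "\<exists>r F. 0 < r \<and> finite F \<and> F \<subseteq> A \<and> (\<forall>x\<in>A. \<exists>a\<in>F. N (x - a) < ennreal r)"
  then obtain r F where r: "0 < r" "finite F" "F \<subseteq> A" "\<And>x. x \<in> A \<Longrightarrow> \<exists>a\<in>F. N (x - a) < ennreal r"
    by blast
  show "ext_bounded sc N A"
    unfolding ext_bounded_def
  proof (intro allI impI)
    fix U assume "\<exists>W. openin (ext_topology N) W \<and> 0 \<in> W \<and> W \<subseteq> U"
    then obtain W where W: "openin (ext_topology N) W" "0 \<in> W" "W \<subseteq> U" by blast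
    obtain e where e: "e > 0" "\<forall>y. N y < ennreal e \<longrightarrow> y \<in> W"
      using W(1,2) by (rule ext_nbhd_0)
    let ?s = "r / e"
    have s: "?s > 0" using e r by simp
    have "\<exists>a u. x = a + sc (of_real ?s) u \<and> a \<in> F \<and> u \<in> U" if x: "x \<in> A" for x
    proof -
      obtain a where a: "a \<in> F" "N (x - a) < ennreal r" using r(4)[OF x] by blast
      let ?u = "sc (of_real (e / r)) (x - a)"
      have "N ?u = ennreal (e / r) * N (x - a)"
        using e(1) r(1) by (simp add: ext_norm_scale norm_divide)
      also have "\<dots> < ennreal (e / r) * ennreal r"
        using a(2) e(1) r(1) by (intro ennreal_mult_strict_left_mono) simp_all
      also have "\<dots> = ennreal e" using e(1) r(1) by (simp flip: ennreal_mult)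
      finally have "?u \<in> U" using e(2) W(3) by blast
      moreover have "(of_real ?s :: 'k) * of_real (e / r) = 1" using e(1) r(1) by simp
      then have "x = a + sc (of_real ?s) ?u" unfolding scale_scale by simp
      ultimately show ?thesis using a by blast
    qed
    then have "A \<subseteq> {a + sc (of_real ?s) u | a u. a \<in> F \<and> u \<in> U}"
      by (intro subsetI CollectI)
    then show "\<exists>r. 0 < r \<and> (\<exists>F. finite F \<and> F \<subseteq> A \<and> A \<subseteq> {a + sc (of_real r) u | a u. a \<in> F \<and> u \<in> U})"
      using s r(2,3) by (intro exI[of _ ?s] conjI exI[of _ F])
  qed
qed

lemma ext_boundedE:
  assumes "ext_bounded sc N A"
  obtains r F where "0 < r" "finite F" "F \<subseteq> A" "\<forall>x\<in>A. \<exists>a\<in>F. N (x - a) < ennreal r"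
  using assms unfolding ext_bounded_iff by (elim exE conjE) (rule that)

lemma cont_dual_bdd_above_on_bounded:
  assumes B: "ext_bounded sc N B" and f: "f \<in> cont_dual sc N"
  shows "bdd_above (insert 0 ((\<lambda>x. norm (f x)) ` B))"
proof -
  obtain r F where r: "0 < r" "finite F" "F \<subseteq> B" "\<forall>x\<in>B. \<exists>a\<in>F. N (x - a) < ennreal r"
    using B by (rule ext_boundedE)
  obtain C where C: "0 \<le> C" "\<And>x. x \<in> X\<^sub>f\<^sub>i\<^sub>n \<Longrightarrow> norm (f x) \<le> C * enn2real (N x)"
    using cont_dual_bound[OF f] by blast
  have "norm (f x) \<le> (\<Sum>a\<in>F. norm (f a)) + C * r" if "x \<in> B" for x
  proof -
    obtain a where a: "a \<in> F" "N (x - a) < ennreal r" using r(4) \<open>x \<in> B\<close> by blast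
    have "x - a \<in> X\<^sub>f\<^sub>i\<^sub>n" using a(2) by (rule in_fin_subspace)
    then have "norm (f (x - a)) \<le> C * enn2real (N (x - a))" by (rule C(2))
    also have "\<dots> \<le> C * r"
      using C(1) a r(1) by (intro mult_left_mono enn2real_leI) auto
    finally have "norm (f x - f a) \<le> C * r" by (simp add: functional_diff functional_cont_dual f)
    moreover have "norm (f a) \<le> (\<Sum>a\<in>F. norm (f a))" using a r(2) by (intro member_le_sum) auto
    ultimately show ?thesis using norm_triangle_sub[of "f x" "f a"] by linarith
  qed
  then have "bdd_above ((\<lambda>x. norm (f x)) ` B)" by (rule bdd_aboveI2)
  then show ?thesis by simp
qed

lemma norm_le_sup_seminorm:
  assumes "ext_bounded sc N B" "f \<in> cont_dual sc N" "x \<in> B"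
  shows "norm (f x) \<le> sup_seminorm B f"
  unfolding sup_seminorm_def
  by (rule cSup_upper[OF _ cont_dual_bdd_above_on_bounded]) (use assms in auto)

lemma sup_seminorm_nonneg:
  assumes "ext_bounded sc N B" "f \<in> cont_dual sc N"
  shows "0 \<le> sup_seminorm B f"
  unfolding sup_seminorm_def
  by (rule cSup_upper[OF _ cont_dual_bdd_above_on_bounded]) (use assms in auto)

lemma sup_seminorm_least: "0 \<le> c \<Longrightarrow> (\<And>x. x \<in> B \<Longrightarrow> norm (f x) \<le> c) \<Longrightarrow> sup_seminorm B f \<le> c"
  unfolding sup_seminorm_def by (rule cSup_least) auto

text \<open>All suprema are finite by continuity of the functionals; without that, the supremum of an
  unbounded set of reals would be an arbitrary value.\<close>

lemma seminorm_sup_seminorm: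
  assumes B: "ext_bounded sc N B"
  shows "seminorm_on dual_scale (cont_dual sc N) (sup_seminorm B)"
  unfolding seminorm_on_def
proof (intro conjI ballI allI)
  fix f g :: "'a \<Rightarrow> 'k" and c :: 'k
  assume f: "f \<in> cont_dual sc N"
  show nonneg: "0 \<le> sup_seminorm B f" using sup_seminorm_nonneg[OF B f] .
  have "mono (\<lambda>t. norm c * t)" by (simp add: mono_def mult_left_mono)
  then have "norm c * sup_seminorm B f = Sup ((\<lambda>t. norm c * t) ` insert 0 ((\<lambda>x. norm (f x)) ` B))"
    unfolding sup_seminorm_def
    by (rule continuous_at_Sup_mono)
       (use cont_dual_bdd_above_on_bounded[OF B f] in \<open>auto intro!: continuous_intros\<close>)
  also have "\<dots> = sup_seminorm B (dual_scale c f)"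
    by (simp add: sup_seminorm_def dual_scale_def norm_mult image_image)
  finally show "sup_seminorm B (dual_scale c f) = norm c * sup_seminorm B f" by simp
  assume g: "g \<in> cont_dual sc N"
  show "sup_seminorm B (f + g) \<le> sup_seminorm B f + sup_seminorm B g"
  proof (rule sup_seminorm_least)
    show "0 \<le> sup_seminorm B f + sup_seminorm B g"
      using sup_seminorm_nonneg[OF B] f g by (simp add: add_nonneg_nonneg)
    fix x assume x: "x \<in> B"
    then show "norm ((f + g) x) \<le> sup_seminorm B f + sup_seminorm B g"
      using norm_triangle_ineq[of "f x" "g x"] norm_le_sup_seminorm[OF B f x]
        norm_le_sup_seminorm[OF B g x] by simp
  qed
qed

sublocale dual: seminorm_family dual_scale "cont_dual sc N" "{sup_seminorm B | B. ext_bounded sc N B}"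
proof
  show "dual_scale 0 0 = (0 :: 'a \<Rightarrow> 'k)" by (simp add: dual_scale_def fun_eq_iff)
  show "seminorm_on dual_scale (cont_dual sc N) p"
    if "p \<in> {sup_seminorm B | B. ext_bounded sc N B}" for p
  proof -
    obtain B where "p = sup_seminorm B" "ext_bounded sc N B" using \<open>p \<in> _\<close> by blast
    then show ?thesis using seminorm_sup_seminorm by simp
  qed
qed (fact cont_dual_zero, fact cont_dual_diff)

text \<open>The norm is the supremum over the bounded set \<open>B\<close> that consists of the unit ball and the
  finite set \<open>D\<close>. It controls \<open>f\<close> on \<open>X\<^sub>f\<^sub>i\<^sub>n\<close> through the ball and on the coordinate directions
  through \<open>D\<close>, hence at every vector, and therefore on finitely many balls.\<close>

lemma almost_conventional_imp_normable_ucb: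
  assumes "almost_conventional sc N"
  shows "normable dual_scale (cont_dual sc N) (ucb_topology sc N)"
proof -
  obtain D :: "'a set" and \<phi> where D: "finite D"
    and "\<And>d. functional (\<phi> d)" "\<And>d x. d \<in> D \<Longrightarrow> x \<in> X\<^sub>f\<^sub>i\<^sub>n \<Longrightarrow> \<phi> d x = 0"
    and fin: "\<And>x. x - (\<Sum>d\<in>D. sc (\<phi> d x) d) \<in> X\<^sub>f\<^sub>i\<^sub>n"
    using coordinates_mod_fin[OF assms] by blast
  define B where "B = {x. N x \<le> 1} \<union> D"
  let ?V = "cont_dual sc N" and ?q = "sup_seminorm B"
  have "N 0 = 0" using ext_norm_eq_zero_iff by simp
  have B: "ext_bounded sc N B"
    unfolding ext_bounded_iff
  proof (intro exI[of _ 2] exI[of _ "insert 0 D"] conjI ballI)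
    fix x assume "x \<in> B"
    then consider "N x \<le> 1" | "x \<in> D" by (auto simp: B_def)
    then show "\<exists>a\<in>insert 0 D. N (x - a) < ennreal 2"
    proof cases
      case 1
      then have "N x < ennreal 2" by (rule le_less_trans) (simp flip: ennreal_1 add: ennreal_less_iff)
      then show ?thesis by simp
    next
      case 2
      then show ?thesis using \<open>N 0 = 0\<close> by (intro bexI[of _ x]) auto
    qed
  qed (use D \<open>N 0 = 0\<close> in \<open>auto simp: B_def\<close>)
  have q: "seminorm_on dual_scale ?V ?q" by (rule seminorm_sup_seminorm[OF B])
  \<comment> \<open>The factor 2 comes from scaling a vector strictly into the open unit ball.\<close>
  have on_fin: "norm (f x) \<le> 2 * enn2real (N x) * ?q f" if f: "f \<in> ?V" and x: "x \<in> X\<^sub>f\<^sub>i\<^sub>n" for f x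
  proof -
    have "norm (f y) \<le> ?q f" if "N y < ennreal 1" for y
      using that by (intro norm_le_sup_seminorm[OF B f]) (simp add: B_def less_imp_le)
    then have "norm (f x) \<le> 2 * ?q f / 1 * enn2real (N x)"
      using seminorm_norm_functional[OF functional_cont_dual[OF f]] x
      by (intro seminorm_bound_of_ball_bound) auto
    then show ?thesis by (simp add: mult_ac)
  qed
  have on_all: "norm (f x) \<le> (2 * enn2real (N (x - (\<Sum>d\<in>D. sc (\<phi> d x) d))) + (\<Sum>d\<in>D. norm (\<phi> d x))) * ?q f"
    if f: "f \<in> ?V" for f x
  proof -
    let ?s = "\<Sum>d\<in>D. sc (\<phi> d x) d"
    have "norm (f ?s) \<le> (\<Sum>d\<in>D. norm (\<phi> d x) * norm (f d))"
      unfolding functional_sum[OF functional_cont_dual[OF f]] by (rule sum_norm_le) (simp add: norm_mult)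
    also have "\<dots> \<le> (\<Sum>d\<in>D. norm (\<phi> d x) * ?q f)"
      by (intro sum_mono mult_left_mono norm_le_sup_seminorm[OF B f]) (auto simp: B_def)
    finally have "norm (f ?s) \<le> (\<Sum>d\<in>D. norm (\<phi> d x)) * ?q f" by (simp add: sum_distrib_right)
    moreover have "norm (f x) \<le> norm (f (x - ?s)) + norm (f ?s)"
      using norm_triangle_ineq[of "f (x - ?s)" "f ?s"]
      by (simp add: functional_diff[OF functional_cont_dual[OF f]])
    ultimately show ?thesis using on_fin[OF f fin[of x]] by (simp add: distrib_right)
  qed
  have "norm_on dual_scale ?V ?q"
    unfolding norm_on_def
  proof (intro conjI q ballI impI)
    fix f assume "f \<in> ?V" "?q f = 0"
    then show "f = 0" using on_all[of f] by (simp add: fun_eq_iff)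
  qed
  moreover have "coarser (ucb_topology sc N) (seminorm_topology ?V {?q})"
    unfolding ucb_topology_def
  proof (rule dual.coarser_seminorm_topology_dominated[OF q])
    fix p :: "('a \<Rightarrow> 'k) \<Rightarrow> real"
    assume "p \<in> {sup_seminorm A | A. ext_bounded sc N A}"
    then obtain A where A: "p = sup_seminorm A" "ext_bounded sc N A" by blast
    obtain r F where r: "0 < r" "finite F" "F \<subseteq> A" "\<forall>x\<in>A. \<exists>a\<in>F. N (x - a) < ennreal r"
      using A(2) by (rule ext_boundedE)
    define c where "c a = 2 * enn2real (N (a - (\<Sum>d\<in>D. sc (\<phi> d a) d))) + (\<Sum>d\<in>D. norm (\<phi> d a))" for a
    have c: "0 \<le> c a" for a by (simp add: c_def sum_nonneg)
    have "p f \<le> (2 * r + (\<Sum>a\<in>F. c a)) * ?q f" if f: "f \<in> ?V" for f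
      unfolding A(1)
    proof (rule sup_seminorm_least)
      have q0: "0 \<le> ?q f" by (rule sup_seminorm_nonneg[OF B f])
      then show "0 \<le> (2 * r + (\<Sum>a\<in>F. c a)) * ?q f" using r(1) c by (simp add: sum_nonneg)
      fix x assume "x \<in> A"
      then obtain a where a: "a \<in> F" "N (x - a) < ennreal r" using r(4) by blast
      have "x - a \<in> X\<^sub>f\<^sub>i\<^sub>n" using a(2) by (rule in_fin_subspace)
      then have "norm (f (x - a)) \<le> 2 * enn2real (N (x - a)) * ?q f" by (rule on_fin[OF f])
      also have "\<dots> \<le> 2 * r * ?q f"
        using a r(1) q0 by (intro mult_right_mono mult_left_mono enn2real_leI) auto
      finally have "norm (f x - f a) \<le> 2 * r * ?q f"
        by (simp add: functional_diff[OF functional_cont_dual[OF f]])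
      moreover have "norm (f a) \<le> c a * ?q f" using on_all[OF f] by (simp add: c_def)
      moreover have "c a * ?q f \<le> (\<Sum>a\<in>F. c a) * ?q f"
        using a r(2) c q0 by (intro mult_right_mono member_le_sum) auto
      ultimately show "norm (f x) \<le> (2 * r + (\<Sum>a\<in>F. c a)) * ?q f"
        using norm_triangle_sub[of "f x" "f a"] by (simp add: distrib_right)
    qed
    then show "\<exists>C. \<forall>f\<in>?V. p f \<le> C * ?q f" by blast
  qed
  moreover have "coarser (seminorm_topology ?V {?q}) (ucb_topology sc N)"
    unfolding ucb_topology_def by (rule coarser_seminorm_topology_mono) (use B in blast)
  ultimately show ?thesis
    unfolding normable_def by (intro exI[of _ ?q] conjI coarser_antisym)
qed

text \<open>The unit ball of a norm \<open>\<rho>\<close> that induces the topology would contain all functionals that are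
  small on finitely many bounded sets. Such sets lie in finitely many translates of \<open>X\<^sub>f\<^sub>i\<^sub>n\<close>, so a
  functional \<open>f \<noteq> 0\<close> vanishes on them if \<open>X / X\<^sub>f\<^sub>i\<^sub>n\<close> has infinite dimension. The multiple of \<open>f\<close> with
  \<open>\<rho>\<close>-norm 1 then belongs to the open unit ball.\<close>

lemma normable_ucb_imp_almost_conventional:
  assumes "normable dual_scale (cont_dual sc N) (ucb_topology sc N)"
  shows "almost_conventional sc N"
proof (rule ccontr)
  assume not_ac: "\<not> almost_conventional sc N"
  let ?V = "cont_dual sc N"
  obtain \<rho> where \<rho>: "norm_on dual_scale ?V \<rho>" "ucb_topology sc N = seminorm_topology ?V {\<rho>}"
    using assms by (auto simp: normable_def)
  have s\<rho>: "seminorm_on dual_scale ?V \<rho>" using \<rho>(1) by (simp add: norm_on_def)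
  interpret \<rho>: seminorm_family dual_scale ?V "{\<rho>}"
    by unfold_locales (use dual.zero_mem dual.diff_mem dual.scale_0 s\<rho> in auto)
  have "openin (ucb_topology sc N) {g \<in> ?V. \<rho> g < 1}"
    unfolding \<rho>(2) by (rule \<rho>.openin_unit_ball) simp
  moreover have "0 \<in> {g \<in> ?V. \<rho> g < 1}" using cont_dual_zero \<rho>.seminorm_0 by simp
  ultimately obtain Q e where Q: "finite Q" "Q \<subseteq> {sup_seminorm B | B. ext_bounded sc N B}" "0 < e"
      and ball: "\<forall>g\<in>?V. (\<forall>p\<in>Q. p g < e) \<longrightarrow> g \<in> {g \<in> ?V. \<rho> g < 1}"
    unfolding ucb_topology_def by (rule dual.nbhd_0_contains_ball)
  have "\<exists>F. finite F \<and> (\<forall>f. functional f \<longrightarrow> (\<forall>x\<in>X\<^sub>f\<^sub>i\<^sub>n \<union> F. f x = 0) \<longrightarrow> p f = 0)" if "p \<in> Q" for p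
  proof -
    obtain B where B: "p = sup_seminorm B" "ext_bounded sc N B" using Q(2) \<open>p \<in> Q\<close> by blast
    obtain r F where r: "0 < r" "finite F" "F \<subseteq> B" "\<forall>x\<in>B. \<exists>a\<in>F. N (x - a) < ennreal r"
      using B(2) by (rule ext_boundedE)
    have "p f = 0" if f: "functional f" "\<And>x. x \<in> X\<^sub>f\<^sub>i\<^sub>n \<union> F \<Longrightarrow> f x = 0" for f
    proof -
      have "f x = 0" if x: "x \<in> B" for x
      proof -
        obtain a where a: "a \<in> F" "N (x - a) < ennreal r" using r(4) x by blast
        have "x - a \<in> X\<^sub>f\<^sub>i\<^sub>n" using a(2) by (rule in_fin_subspace)
        then have "f (x - a) = 0" "f a = 0" using f(2) a by auto
        then show ?thesis by (simp add: functional_diff f(1))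
      qed
      then have "insert 0 ((\<lambda>x. norm (f x)) ` B) = {0}" by auto
      then show ?thesis by (simp only: B(1) sup_seminorm_def cSup_singleton)
    qed
    then show ?thesis using r(2) by blast
  qed
  then obtain F where F: "\<And>p. p \<in> Q \<Longrightarrow> finite (F p)"
      "\<And>p f. p \<in> Q \<Longrightarrow> functional f \<Longrightarrow> (\<forall>x\<in>X\<^sub>f\<^sub>i\<^sub>n \<union> F p. f x = 0) \<Longrightarrow> p f = 0"
    by metis
  have "finite (\<Union>p\<in>Q. F p)" using Q(1) F(1) by blast
  then obtain f where f: "functional f" "\<And>x. x \<in> X\<^sub>f\<^sub>i\<^sub>n \<Longrightarrow> f x = 0"
      "\<And>x. x \<in> (\<Union>p\<in>Q. F p) \<Longrightarrow> f x = 0" "f \<noteq> (\<lambda>x. 0)"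
    using annihilator_of_finite_mod_fin[OF not_ac] by metis
  have fV: "f \<in> ?V" using zero_on_fin_in_cont_dual f(1,2) by blast
  have pf: "p f = 0" if "p \<in> Q" for p using F(2)[OF that f(1)] f(2,3) that by blast
  have "\<rho> f \<noteq> 0" using \<rho>(1) fV f(4) by (auto simp: norm_on_def zero_fun_def)
  then have \<rho>f: "\<rho> f > 0" using seminorm_on_nonneg[OF s\<rho> fV] by simp
  define g where "g = dual_scale (of_real (1 / \<rho> f)) f"
  have g: "g \<in> ?V"
    unfolding g_def dual_scale_def
  proof (rule zero_on_fin_in_cont_dual)
    show "functional (\<lambda>x. of_real (1 / \<rho> f) * f x)"
      by (rule functionals.linear_compose_scale_right[OF f(1)])
  qed (simp add: f(2))
  have "p g < e" if "p \<in> Q" for p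
  proof -
    have "seminorm_on dual_scale ?V p" using Q(2) that dual.seminorms by blast
    then have "p g = 0" unfolding g_def using seminorm_on_scale fV pf[OF that] by fastforce
    then show ?thesis using Q(3) by simp
  qed
  then have "\<rho> g < 1" using ball g by blast
  moreover have "\<rho> g = 1"
    unfolding g_def using seminorm_on_scale[OF s\<rho> fV, of "of_real (1 / \<rho> f)"] \<rho>f
    by (simp add: norm_divide)
  ultimately show False by simp
qed

theorem normability_equivalences:
  "(normable dual_scale (cont_dual sc N) (ucb_topology sc N)
      \<longleftrightarrow> normable sc UNIV (flc_topology sc N)) \<and>
    (normable sc UNIV (flc_topology sc N) \<longleftrightarrow> metrizable_space (flc_topology sc N)) \<and>
    (metrizable_space (flc_topology sc N) \<longleftrightarrow> almost_conventional sc N)"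
proof -
  have "normable sc UNIV (flc_topology sc N) \<Longrightarrow> metrizable_space (flc_topology sc N)"
    by (rule metrizable_space_of_normable[where sc = sc]) simp_all
  then show ?thesis
    using almost_conventional_imp_normable_ucb normable_ucb_imp_almost_conventional
      almost_conventional_imp_normable_flc metrizable_flc_imp_almost_conventional by blast
qed

end

theorem theorem5p5:
  fixes sR :: "real \<Rightarrow> 'a::ab_group_add \<Rightarrow> 'a" and N :: "'a \<Rightarrow> ennreal"
    and sC :: "complex \<Rightarrow> 'b::ab_group_add \<Rightarrow> 'b" and M :: "'b \<Rightarrow> ennreal"
  shows "(extended_normed_space sR N \<longrightarrow>
      (normable dual_scale (cont_dual sR N) (ucb_topology sR N)
        \<longleftrightarrow> normable sR UNIV (flc_topology sR N)) \<and>
      (normable sR UNIV (flc_topology sR N)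
        \<longleftrightarrow> metrizable_space (flc_topology sR N)) \<and>
      (metrizable_space (flc_topology sR N)
        \<longleftrightarrow> almost_conventional sR N))
    \<and> (extended_normed_space sC M \<longrightarrow>
      (normable dual_scale (cont_dual sC M) (ucb_topology sC M)
        \<longleftrightarrow> normable sC UNIV (flc_topology sC M)) \<and>
      (normable sC UNIV (flc_topology sC M)
        \<longleftrightarrow> metrizable_space (flc_topology sC M)) \<and>
      (metrizable_space (flc_topology sC M)
        \<longleftrightarrow> almost_conventional sC M))"
  by (intro conjI impI extended_normed_space.normability_equivalences
      [THEN conjunct1] extended_normed_space.normability_equivalences[THEN conjunct2, THEN conjunct1]
      extended_normed_space.normability_equivalences[THEN conjunct2, THEN conjunct2])

end
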